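(* Let $d>3$ be an integer. There is a constant $c_d>0$ such that for all positive integers $n>3$, the maximum, over all sets $\mathcal{O}$ of obstructing unit $d$-hypercubes in $[0,n]^d$, of the number of hypercubes in $\mathcal{O}$ that are visible from the observing unit $d$-hypercube $[0,1]^d$ is at least $c_d\,n^{d-\frac1d}$.
   Context: The hypercube $[0,n]^d$ is partitioned into $n^d$ axis-aligned unit $d$-hypercubes $\prod_{i=1}^d[a_i,a_i+1]$ with $a_i\in\{0,\dots,n-1\}$. The observer is the unit hypercube $[0,1]^d$ adjacent to the origin. A configuration is a set $\mathcal{O}$ of unit hypercubes of this partition, different from the observer, that are declared obstructing; all other hypercubes are empty and lines of sight pass through them freely. An obstructing hypercube $Q\in\mathcal{O}$ is visible from the observer if there are a point $x$ of the observer hypercube and a point $y\in Q$ such that the line segment from $x$ to $y$ is unobstructed, i.e. it does not meet any obstructing hypercube $Q'\in\mathcal{O}$ with $Q'\neq Q$. *)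

theory Defs
  imports "HOL-Analysis.Analysis"
begin

definition unit_hypercube :: "nat ^ 'd \<Rightarrow> (real ^ 'd) set" where
  "unit_hypercube a = cbox (\<chi> i. real (a $ i)) (\<chi> i. real (a $ i) + 1)"

definition hypercubes :: "nat \<Rightarrow> (real ^ 'd) set set" where
  "hypercubes n = {unit_hypercube a | a. \<forall>i. a $ i < n}"

definition observer :: "(real ^ 'd) set" where
  "observer = unit_hypercube 0"

definition configurations :: "nat \<Rightarrow> (real ^ 'd) set set set" where
  "configurations n = {\<O>. \<O> \<subseteq> hypercubes n - {observer}}"

text \<open>Hypercubes and lines of sight are closed sets, so a line of sight that merely touches the
  boundary of another obstructing hypercube is obstructed.\<close>

definition visible :: "(real ^ 'd) set set \<Rightarrow> (real ^ 'd) set \<Rightarrow> bool" where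
  "visible \<O> Q \<longleftrightarrow>
    (\<exists>x\<in>observer. \<exists>y\<in>Q. \<forall>Q'\<in>\<O>. Q' \<noteq> Q \<longrightarrow> closed_segment x y \<inter> Q' = {})"

definition num_visible :: "(real ^ 'd) set set \<Rightarrow> nat" where
  "num_visible \<O> = card {Q \<in> \<O>. visible \<O> Q}"

text \<open>The type argument only carries the dimension \<^term>\<open>CARD('d)\<close>. The maximum is over a
  finite nonempty set by the two lemmas below.\<close>

definition max_visible :: "'d::finite itself \<Rightarrow> nat \<Rightarrow> nat" where
  "max_visible _ n = Max (num_visible ` (configurations n :: (real ^ 'd) set set set))"

lemma finite_hypercubes: "finite (hypercubes n :: (real ^ 'd) set set)"
proof -
  have "hypercubes n \<subseteq> (\<lambda>f :: 'd \<Rightarrow> nat. unit_hypercube (vec_lambda f)) ` (UNIV \<rightarrow>\<^sub>E {..<n})"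
  proof
    fix Q :: "(real ^ 'd) set"
    assume "Q \<in> hypercubes n"
    then obtain a where a: "Q = unit_hypercube a" "\<forall>i. a $ i < n"
      by (auto simp: hypercubes_def)
    have "vec_nth a \<in> UNIV \<rightarrow>\<^sub>E {..<n}"
      using a(2) by auto
    moreover have "Q = unit_hypercube (vec_lambda (vec_nth a))"
      by (simp add: a(1))
    ultimately show "Q \<in> (\<lambda>f. unit_hypercube (vec_lambda f)) ` (UNIV \<rightarrow>\<^sub>E {..<n})"
      by blast
  qed
  then show ?thesis
    by (rule finite_subset) (intro finite_imageI finite_PiE, auto)
qed

lemma finite_configurations: "finite (configurations n :: (real ^ 'd) set set set)"
  unfolding configurations_def by (intro finite_Collect_subsets finite_Diff finite_hypercubes)

lemma configurations_nonempty: "configurations n \<noteq> {}"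
  by (auto simp: configurations_def)

end

theory Submission
  imports Defs
begin

text \<open>Let \<open>d\<close> be the dimension, fix a coordinate \<open>k\<close> and let \<open>Q\<close> be a small multiple of
  \<open>n powr (1 / d)\<close>. Consider the about \<open>Q ^ d\<close> hyperplanes through the origin whose primitive integer
  normals have entries of size at most \<open>2 * Q\<close>. At a lattice point \<open>v\<close> of such a hyperplane put the unit
  cube that touches the hyperplane at \<open>v\<close> only and lies on its nonnegative side. The \<open>k\<close>-th unit
  vector, a point of the observer, is on the negative side of all the hyperplanes, so the segment from
  it to \<open>v\<close> avoids all the other cubes of the hyperplane. If \<open>v\<close> is far from the origin and is not
  just above any other hyperplane, then the segment also misses the cubes of the other hyperplanes:
  all the cubes are far from the origin, and by the time it gets there the segment is, with respect to
  each of these hyperplanes, either on the negative side or too far above it.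

  A hyperplane has about \<open>n ^ (d - 1) / Q\<close> lattice points in the large cube, so it remains to see that at
  least half of them are not just above another hyperplane. For normals \<open>h, h'\<close>, split the lattice
  points into classes on which the form of \<open>h'\<close> is an affine function of a free integer vector, with
  coefficient vector \<open>g E\<close> where \<open>E\<close> is primitive. The fraction of vectors for which it lies in an interval
  of length \<open>C Q\<close> is at most of order \<open>C Q / \<bar>g E\<bar> + 1 / \<bar>E\<bar>\<close>, and for \<open>d > 3\<close> the sum of
  this over all \<open>h'\<close> is \<open>O(Q ^ (d - 1))\<close>, because \<open>\<bar>z\<bar> powr (-2)\<close> is summed over lattice points
  of a space of dimension at least 3. This is small against \<open>n / Q\<close>.\<close>

section \<open>Integer vectors and lattice points in slabs\<close>

definition dot :: "('a::finite \<Rightarrow> int) \<Rightarrow> ('a \<Rightarrow> int) \<Rightarrow> int" where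
  "dot x y = (\<Sum>i\<in>UNIV. x i * y i)"

definition slice :: "'a::finite \<Rightarrow> int set \<Rightarrow> ('a \<Rightarrow> int) set" where
  "slice k A = {f. f k = 0 \<and> (\<forall>i. i \<noteq> k \<longrightarrow> f i \<in> A)}"

definition maxabs :: "('a::finite \<Rightarrow> int) \<Rightarrow> int" where
  "maxabs z = Max (range (\<lambda>i. \<bar>z i\<bar>))"

lemma card_family:
  fixes X :: "'a::finite \<Rightarrow> int set"
  shows "card {f. \<forall>i. f i \<in> X i} = (\<Prod>i\<in>UNIV. card (X i))"
proof -
  have "{f. \<forall>i. f i \<in> X i} = PiE UNIV X" by (auto simp: PiE_iff)
  then show ?thesis by (simp add: card_PiE)
qed

lemma finite_family:
  fixes X :: "'a::finite \<Rightarrow> int set"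
  assumes "\<And>i. finite (X i)"
  shows "finite {f. \<forall>i. f i \<in> X i}"
proof -
  have "{f. \<forall>i. f i \<in> X i} = PiE UNIV X" by (auto simp: PiE_iff)
  then show ?thesis using assms by (simp add: finite_PiE)
qed

lemma slice_eq_family: "slice k A = {f. \<forall>i. f i \<in> (if i = k then {0} else A)}"
  by (auto simp: slice_def split: if_splits)

lemma finite_slice: "finite A \<Longrightarrow> finite (slice k A)"
  unfolding slice_eq_family by (rule finite_family) auto

lemma prod_except_one:
  fixes k :: "'a::finite" and a b :: "'b::comm_monoid_mult"
  shows "(\<Prod>i\<in>UNIV. if i = k then a else b) = a * b ^ (CARD('a) - 1)"
proof -
  have "(\<Prod>i\<in>UNIV. if i = k then a else b) = a * (\<Prod>i\<in>UNIV - {k}. if i = k then a else b)"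
    by (subst prod.remove[of _ k]) auto
  also have "(\<Prod>i\<in>UNIV - {k}. if i = k then a else b) = (\<Prod>i\<in>UNIV - {k}. b)"
    by (rule prod.cong) auto
  finally show ?thesis by simp
qed

lemma card_slice: "card (slice (k :: 'a::finite) A) = card A ^ (CARD('a) - 1)"
proof -
  have "card (slice k A) = (\<Prod>i\<in>UNIV. if i = k then 1 else card A)"
    unfolding slice_eq_family card_family by (rule prod.cong) auto
  then show ?thesis by (simp add: prod_except_one del: prod.If_cases)
qed

lemma abs_le_maxabs: "\<bar>z i\<bar> \<le> maxabs z"
  by (simp add: maxabs_def)

lemma maxabs_attained: obtains i where "maxabs z = \<bar>z i\<bar>"
proof -
  have "maxabs z \<in> range (\<lambda>i. \<bar>z i\<bar>)" unfolding maxabs_def by (rule Max_in) auto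
  then show ?thesis using that by auto
qed

lemma maxabs_le_iff: "maxabs z \<le> b \<longleftrightarrow> (\<forall>i. \<bar>z i\<bar> \<le> b)"
  by (simp add: maxabs_def)

lemma maxabs_pos_iff: "maxabs z \<ge> 1 \<longleftrightarrow> (\<exists>i. z i \<noteq> 0)"
proof -
  have "maxabs z \<le> 0 \<longleftrightarrow> (\<forall>i. z i = 0)" by (simp add: maxabs_le_iff)
  then show ?thesis by (metis int_one_le_iff_zero_less linorder_not_less)
qed

lemma dot_diff_right: "dot x (\<lambda>i. y i - z i) = dot x y - dot x z"
  by (simp add: dot_def algebra_simps sum_subtractf)

lemma dot_add_right: "dot x (\<lambda>i. y i + z i) = dot x y + dot x z"
  by (simp add: dot_def algebra_simps sum.distrib)

lemma dot_scale_right: "dot x (\<lambda>i. c * y i) = c * dot x y"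
  by (simp add: dot_def algebra_simps sum_distrib_left)

lemma dot_scale_left: "dot (\<lambda>i. c * x i) y = c * dot x y"
  by (simp add: dot_def algebra_simps sum_distrib_left)

lemma dot_unit: "dot x (\<lambda>i. if i = j then 1 else 0) = x j"
  by (simp add: dot_def if_distrib cong: if_cong)

text \<open>The least positive integer combination of the entries of \<open>D\<close> divides all of
  them, so it serves as \<open>g\<close>. Its coefficients \<open>s\<close> then certify that
  \<open>E\<close> has no common factor.\<close>

lemma primitive_factor:
  fixes D :: "'a::finite \<Rightarrow> int"
  assumes "D j \<noteq> 0"
  obtains g E s where "g > 0" "D = (\<lambda>i. g * E i)" "dot E s = 1"
proof -
  define P where "P n \<longleftrightarrow> n > 0 \<and> (\<exists>s. int n = dot D s)" for n :: nat
  have "P (nat \<bar>D j\<bar>)"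
  proof -
    have "\<bar>D j\<bar> = dot D (\<lambda>i. sgn (D j) * (if i = j then 1 else 0))"
      unfolding dot_scale_right dot_unit by (simp add: abs_sgn)
    then show ?thesis using assms unfolding P_def by (auto simp del: mult_if_delta)
  qed
  define n where "n = (LEAST n. P n)"
  have "P n" unfolding n_def using \<open>P (nat \<bar>D j\<bar>)\<close> by (rule LeastI)
  then obtain s where n: "n > 0" and s: "int n = dot D s" unfolding P_def by auto
  have "int n dvd D i" for i
  proof (rule ccontr)
    assume "\<not> int n dvd D i"
    moreover have "0 \<le> D i mod int n" "D i mod int n < int n" using n by auto
    ultimately have r: "0 < D i mod int n" "D i mod int n < int n" by (auto simp: dvd_eq_mod_eq_0)
    \<comment> \<open>The remainder is again an integer combination of the entries, and it is
      smaller than \<open>n\<close>.\<close>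
    have "D i mod int n = dot D (\<lambda>l. (if l = i then 1 else 0) - (D i div int n) * s l)"
      unfolding dot_diff_right dot_scale_right dot_unit s[symmetric]
      by (simp add: minus_div_mult_eq_mod[symmetric])
    then have "P (nat (D i mod int n))" using r unfolding P_def by force
    then have "n \<le> nat (D i mod int n)" unfolding n_def by (rule Least_le)
    then show False using r by linarith
  qed
  then have D: "D = (\<lambda>i. int n * (D i div int n))" by auto
  have "int n * 1 = int n * dot (\<lambda>i. D i div int n) s"
    using s by (subst dot_scale_left[symmetric], subst D[symmetric]) simp
  then have "dot (\<lambda>i. D i div int n) s = 1" using n by simp
  then show ?thesis using that[of "int n"] D n by auto
qed

text \<open>Translating the solutions by vectors which realise every residue modulo \<^term>\<open>E j\<close> yields
  \<^term>\<open>\<bar>E j\<bar>\<close> disjoint sets of projections along the coordinate \<^term>\<open>j\<close>.\<close>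

lemma card_hyperplane_slice:
  fixes E :: "'a::finite \<Rightarrow> int"
  assumes s: "dot E s = 1" and k: "E k = 0" and j: "E j \<noteq> 0" and T: "\<bar>E j\<bar> \<le> T"
  shows "\<bar>E j\<bar> * int (card {t \<in> slice k {0..<T}. dot E t = w}) \<le> (2 * T) ^ (CARD('a) - 2)"
proof -
  define p where "p = \<bar>E j\<bar>"
  have p: "p > 0" and T0: "T > 0" and jk: "j \<noteq> k" using j T k by (auto simp: p_def)
  define S where "S = {t \<in> slice k {0..<T}. dot E t = w}"
  \<comment> \<open>Coordinate \<open>j\<close> is dropped, which saves one exponent. Every other
    free entry is below \<open>T\<close> and gains a residue below \<open>p \<le> T\<close>, hence
    the range \<open>2 * T\<close>.\<close>
  define \<phi> where "\<phi> = (\<lambda>(e, t) i. if i = k \<or> i = j then 0 else t i + (e * s i) mod p)"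
  define X where "X i = (if i = k \<or> i = j then {0} else {0..<2 * T})" for i
  have fS: "finite S" unfolding S_def using finite_slice[of "{0..<T}" k] by simp
  have img: "\<phi> ` ({0..<p} \<times> S) \<subseteq> {f. \<forall>i. f i \<in> X i}"
  proof (clarify)
    fix e t i assume "e \<in> {0..<p}" and t: "t \<in> S"
    have "0 \<le> (e * s i) mod p" "(e * s i) mod p < T" using p T pos_mod_bound[of p "e * s i"]
      unfolding p_def[symmetric] by (simp, linarith)
    moreover have "i \<noteq> k \<Longrightarrow> 0 \<le> t i \<and> t i < T" using t by (auto simp: S_def slice_def)
    ultimately show "\<phi> (e, t) i \<in> X i"
      by (auto simp: \<phi>_def X_def)
  qed
  \<comment> \<open>Modulo \<open>p\<close> neither the dropped coordinate (as \<open>p\<close>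
    divides \<open>E j\<close>) nor the reduction of \<open>e * s i\<close> changes the form, so the
    image determines \<open>e\<close>.\<close>
  have res: "p dvd dot E (\<phi> (e, t)) - (w + e)" if "t \<in> S" for e t
  proof -
    have "dot E (\<phi> (e, t)) - (dot E t + e * dot E s)
        = (\<Sum>i\<in>UNIV. E i * (\<phi> (e, t) i - t i - e * s i))"
      by (simp add: dot_def algebra_simps sum_subtractf sum.distrib sum_distrib_left)
    moreover have "p dvd E i * (\<phi> (e, t) i - t i - e * s i)" for i
    proof (cases "i = k \<or> i = j")
      case True
      then show ?thesis using k by (auto simp: p_def)
    next
      case False
      have "p dvd (e * s i) mod p - e * s i" by (simp add: mod_eq_dvd_iff[symmetric])
      then show ?thesis using False by (simp add: \<phi>_def)
    qed
    ultimately show ?thesis using that s by (simp add: S_def dvd_sum)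
  qed
  have inj: "inj_on \<phi> ({0..<p} \<times> S)"
  proof (rule inj_onI, clarify)
    fix e t e' t'
    assume e: "e \<in> {0..<p}" "e' \<in> {0..<p}" and t: "t \<in> S" "t' \<in> S"
      and eq: "\<phi> (e, t) = \<phi> (e', t')"
    have "p dvd (dot E (\<phi> (e', t')) - (w + e')) - (dot E (\<phi> (e', t')) - (w + e))"
      using res[OF t(1), of e] res[OF t(2), of e'] unfolding eq by (rule dvd_diff[rotated])
    moreover have "(dot E (\<phi> (e', t')) - (w + e')) - (dot E (\<phi> (e', t')) - (w + e)) = e - e'"
      by simp
    ultimately have "e mod p = e' mod p" by (simp only: mod_eq_dvd_iff)
    then have ee: "e = e'" using e by simp
    have other: "t i = t' i" if "i \<noteq> j" for i
    proof (cases "i = k")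
      case True
      then show ?thesis using t by (simp add: S_def slice_def)
    next
      case False
      then show ?thesis using fun_cong[OF eq, of i] that ee by (simp add: \<phi>_def)
    qed
    \<comment> \<open>Once the other coordinates agree, the common value \<open>w\<close> of the
      form fixes entry \<open>j\<close>.\<close>
    have "dot E (\<lambda>i. t i - t' i) = 0" using t by (simp add: dot_diff_right S_def)
    moreover have "dot E (\<lambda>i. t i - t' i) = E j * (t j - t' j)"
      unfolding dot_def by (subst sum.remove[of _ j]) (auto simp: other)
    ultimately have "t j = t' j" using j by simp
    then have "t = t'" using other by (metis ext)
    then show "e = e' \<and> t = t'" using ee by simp
  qed
  have "card ({0..<p} \<times> S) \<le> card {f. \<forall>i. f i \<in> X i}"
    using img inj by (intro card_inj_on_le[of \<phi>] finite_family) (auto simp: X_def)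
  also have "\<dots> = (\<Prod>i\<in>UNIV - {k, j}. nat (2 * T))"
    unfolding card_family by (rule prod.mono_neutral_cong_right) (auto simp: X_def)
  also have "\<dots> = nat (2 * T) ^ (CARD('a) - 2)" using jk by (simp add: card_Diff_subset numeral_2_eq_2)
  finally have "nat p * card S \<le> nat (2 * T) ^ (CARD('a) - 2)" by (simp add: card_cartesian_product)
  then have "int (nat p * card S) \<le> int (nat (2 * T) ^ (CARD('a) - 2))" by (rule of_nat_mono)
  then show ?thesis using p T0 by (simp add: S_def p_def)
qed

text \<open>Elements that are congruent modulo \<open>p\<close> are told apart by the quotients
  \<open>(x - a) div p\<close>, which lie between 0 and \<open>(b - a) div p\<close>.\<close>

lemma card_congruent_le:
  fixes A :: "int set" and a b p :: int
  assumes p: "p > 0" and ab: "A \<subseteq> {a..b}" "a \<le> b + 1" and c: "\<And>x y. x \<in> A \<Longrightarrow> y \<in> A \<Longrightarrow> p dvd x - y"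
  shows "real (card A) \<le> (b - a) / p + 1"
proof (cases "a \<le> b")
  case True
  define f where "f x = (x - a) div p" for x
  have "inj_on f A"
  proof (rule inj_onI)
    fix x y assume xy: "x \<in> A" "y \<in> A" "f x = f y"
    have "(x - a) mod p = (y - a) mod p" using c[OF xy(1,2)] by (simp add: mod_eq_dvd_iff)
    then have "x - a = y - a" using xy(3) unfolding f_def by (metis div_mult_mod_eq)
    then show "x = y" by simp
  qed
  moreover have "f ` A \<subseteq> {0..(b - a) div p}"
    using p by (auto simp: f_def pos_imp_zdiv_nonneg_iff intro!: zdiv_mono1 dest!: subsetD[OF ab(1)])
  ultimately have "card A \<le> card {0..(b - a) div p}" by (intro card_inj_on_le[of f]) auto
  then have "int (card A) \<le> (b - a) div p + 1"
    using True p by (simp add: pos_imp_zdiv_nonneg_iff nat_add_distrib zle_int[symmetric] del: zle_int)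
  then have "real (card A) \<le> of_int ((b - a) div p) + 1" by linarith
  also have "of_int ((b - a) div p) \<le> of_int (b - a) / (of_int p :: real)"
    by (rule real_of_int_div4)
  finally show ?thesis by simp
next
  case False
  then have "A = {}" "b = a - 1" using ab by auto
  then show ?thesis using p by (simp add: field_simps)
qed

text \<open>The values taken in the slab are all congruent to \<open>c\<close> modulo
  \<open>g\<close>, so there are at most \<open>W / g + 1\<close> of them. Each belongs to one
  hyperplane of \<open>E\<close>, to which \<open>card_hyperplane_slice\<close> applies.\<close>

lemma card_slab_slice:
  fixes E :: "'a::finite \<Rightarrow> int"
  assumes s: "dot E s = 1" and k: "E k = 0" and g: "g > 0" and W: "W \<ge> 0" and T: "maxabs E \<le> T"
  shows "real (card {t \<in> slice k {0..<T}. c + dot (\<lambda>i. g * E i) t \<in> {0..W}})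
    \<le> (W / (g * maxabs E) + 1 / maxabs E) * (2 * T) ^ (CARD('a) - 2)"
proof -
  obtain j where j: "maxabs E = \<bar>E j\<bar>" by (rule maxabs_attained)
  have "\<exists>i. E i \<noteq> 0"
  proof (rule ccontr)
    assume "\<nexists>i. E i \<noteq> 0"
    then have "dot E s = 0" by (simp add: dot_def)
    then show False using s by simp
  qed
  then have m: "maxabs E \<ge> 1" by (simp add: maxabs_pos_iff)
  then have T0: "T \<ge> 1" using T by linarith
  define A where "A = {w'. g dvd w' - c \<and> w' \<in> {0..W}}"
  have fA: "finite A" by (rule finite_subset[of _ "{0..W}"]) (auto simp: A_def)
  have cA: "real (card A) \<le> (W - 0) / g + 1"
  proof -
    have "g dvd x - y" if "x \<in> A" "y \<in> A" for x y
    proof -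
      have "g dvd x - c" "g dvd y - c" using that by (auto simp: A_def)
      then have "g dvd (x - c) - (y - c)" by (rule dvd_diff)
      then show ?thesis by simp
    qed
    moreover have "A \<subseteq> {0..W}" by (auto simp: A_def)
    ultimately show ?thesis using g W by (intro card_congruent_le) auto
  qed
  define S where "S w = {t \<in> slice k {0..<T}. dot E t = w}" for w
  have fS: "finite (S w)" for w unfolding S_def using finite_slice[of "{0..<T}" k] by simp
  have cS: "real (card (S w)) \<le> (2 * T) ^ (CARD('a) - 2) / maxabs E" for w
  proof -
    have "\<bar>E j\<bar> * int (card (S w)) \<le> (2 * T) ^ (CARD('a) - 2)"
      unfolding S_def using s k m j T by (intro card_hyperplane_slice) auto
    then have "real_of_int (maxabs E * int (card (S w))) \<le> real_of_int ((2 * T) ^ (CARD('a) - 2))"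
      unfolding j of_int_le_iff .
    then show ?thesis using m by (simp add: field_simps)
  qed
  have "{t \<in> slice k {0..<T}. c + dot (\<lambda>i. g * E i) t \<in> {0..W}} \<subseteq> (\<Union>w'\<in>A. S ((w' - c) div g))"
  proof clarify
    fix t assume t: "t \<in> slice k {0..<T}" "c + dot (\<lambda>i. g * E i) t \<in> {0..W}"
    then have "c + dot (\<lambda>i. g * E i) t \<in> A" by (simp add: A_def dot_scale_left)
    moreover have "t \<in> S ((c + dot (\<lambda>i. g * E i) t - c) div g)"
      using t g by (simp add: S_def dot_scale_left)
    ultimately show "t \<in> (\<Union>w'\<in>A. S ((w' - c) div g))" by blast
  qed
  then have "card {t \<in> slice k {0..<T}. c + dot (\<lambda>i. g * E i) t \<in> {0..W}} \<le> card (\<Union>w'\<in>A. S ((w' - c) div g))"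
    using fA fS by (intro card_mono) auto
  also have "\<dots> \<le> (\<Sum>w'\<in>A. card (S ((w' - c) div g)))" using fA by (rule card_UN_le)
  finally have "real (card {t \<in> slice k {0..<T}. c + dot (\<lambda>i. g * E i) t \<in> {0..W}})
      \<le> real (\<Sum>w'\<in>A. card (S ((w' - c) div g)))" by (rule of_nat_mono)
  also have "\<dots> \<le> (\<Sum>w'\<in>A. (2 * T) ^ (CARD('a) - 2) / maxabs E)"
    unfolding of_nat_sum by (rule sum_mono) (rule cS)
  also have "\<dots> = card A * ((2 * T) ^ (CARD('a) - 2) / maxabs E)" by simp
  also have "\<dots> \<le> (W / g + 1) * ((2 * T) ^ (CARD('a) - 2) / maxabs E)"
    using cA m T0 by (intro mult_right_mono) auto
  also have "\<dots> = (W / (g * maxabs E) + 1 / maxabs E) * (2 * T) ^ (CARD('a) - 2)"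
    using m g by (simp add: field_simps)
  finally show ?thesis by simp
qed

section \<open>Sums over pairs of normals\<close>

text \<open>Some coordinate other than \<open>k\<close> equals \<open>r\<close> or
  \<open>-r\<close>, and each of the remaining \<open>CARD('a) - 2\<close> takes at most
  \<open>2 * r + 1 \<le> 3 * r\<close> values.\<close>

lemma card_shell_slice:
  fixes k :: "'a::finite" and r :: int
  assumes r: "r \<ge> 1" and d: "CARD('a) \<ge> 2"
  shows "real (card {z \<in> slice k {-r..r}. maxabs z = r})
    \<le> 2 * real CARD('a) * (3 * real_of_int r) ^ (CARD('a) - 2)"
proof -
  define B where "B j = {f. \<forall>i. f i \<in> (if i = k then {0} else if i = j then {r, - r} else {-r..r})}" for j
  have fB: "finite (B j)" for j unfolding B_def by (rule finite_family) auto
  have cB: "real (card (B j)) \<le> 2 * (3 * real_of_int r) ^ (CARD('a) - 2)" if jk: "j \<noteq> k" for j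
  proof -
    have "card (B j) = (\<Prod>i\<in>UNIV. card (if i = k then {0} else if i = j then {r, - r} else {-r..r}))"
      unfolding B_def card_family ..
    also have "\<dots> = (\<Prod>i\<in>UNIV - {k}. card (if i = k then {0} else if i = j then {r, - r} else {-r..r}))"
      by (subst prod.remove[of _ k]) auto
    also have "\<dots> = card {r, - r} * (\<Prod>i\<in>UNIV - {k} - {j}. card (if i = k then {0} else if i = j then {r, - r} else {-r..r}))"
      using jk by (subst prod.remove[of _ j]) auto
    also have "(\<Prod>i\<in>UNIV - {k} - {j}. card (if i = k then {0} else if i = j then {r, - r} else {-r..r}))
        = (\<Prod>i\<in>UNIV - {k} - {j}. nat (2 * r + 1))"
      by (rule prod.cong) auto
    also have "\<dots> = nat (2 * r + 1) ^ (CARD('a) - 2)"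
      using jk by (simp add: card_Diff_singleton numeral_2_eq_2)
    also have "card {r, - r} = 2" using r by simp
    finally have "real (card (B j)) = 2 * (2 * real_of_int r + 1) ^ (CARD('a) - 2)" using r by simp
    also have "\<dots> \<le> 2 * (3 * real_of_int r) ^ (CARD('a) - 2)" using r by (intro mult_left_mono power_mono) auto
    finally show ?thesis by simp
  qed
  have "{z \<in> slice k {-r..r}. maxabs z = r} \<subseteq> (\<Union>j\<in>UNIV - {k}. B j)"
  proof clarify
    fix z assume z: "z \<in> slice k {- maxabs z..maxabs z}" "r = maxabs z"
    obtain j where j: "maxabs z = \<bar>z j\<bar>" by (rule maxabs_attained)
    then have "j \<noteq> k" using z r by (auto simp: slice_def)
    moreover have "z \<in> B j" using z j by (auto simp: B_def slice_def abs_if)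
    ultimately show "z \<in> (\<Union>j\<in>UNIV - {k}. B j)" by auto
  qed
  then have "card {z \<in> slice k {-r..r}. maxabs z = r} \<le> card (\<Union>j\<in>UNIV - {k}. B j)"
    using fB by (intro card_mono) auto
  also have "\<dots> \<le> (\<Sum>j\<in>UNIV - {k}. card (B j))" by (rule card_UN_le) auto
  finally have "real (card {z \<in> slice k {-r..r}. maxabs z = r}) \<le> real (\<Sum>j\<in>UNIV - {k}. card (B j))"
    by (rule of_nat_mono)
  also have "\<dots> \<le> (\<Sum>j\<in>UNIV - {k}. 2 * (3 * real_of_int r) ^ (CARD('a) - 2))"
    unfolding of_nat_sum by (rule sum_mono) (use cB in auto)
  also have "\<dots> = card (UNIV - {k}) * (2 * (3 * real_of_int r) ^ (CARD('a) - 2))" by simp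
  also have "\<dots> \<le> CARD('a) * (2 * (3 * real_of_int r) ^ (CARD('a) - 2))"
    using r by (intro mult_right_mono) (auto simp: card_Diff_singleton)
  finally show ?thesis by (simp add: mult_ac)
qed

text \<open>The exponent 2 is below the dimension of the slice, which is where \<^term>\<open>CARD('a) > 3\<close> enters.\<close>

lemma sum_inverse_square_slice:
  fixes k :: "'a::finite" and R :: int
  assumes d: "CARD('a) > 3" and R: "R \<ge> 1"
  shows "(\<Sum>z\<in>slice k {-R..R} - {\<lambda>_. 0}. 1 / (real_of_int (maxabs z))\<^sup>2)
    \<le> (2 * CARD('a) * 3 ^ (CARD('a) - 2)) * real_of_int R ^ (CARD('a) - 3)" (is "?S \<le> _")
proof -
  obtain m where m: "CARD('a) = m + 4"
    using d that[of "CARD('a) - 4"] by simp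
  define A where "A = slice k {-R..R} - {\<lambda>_. 0}"
  define K :: real where "K = 2 * CARD('a) * 3 ^ (m + 2)"
  have fA: "finite A" unfolding A_def using finite_slice[of "{-R..R}" k] by simp
  have "maxabs ` A \<subseteq> {1..R}"
  proof clarify
    fix z assume z: "z \<in> A"
    then have "\<exists>i. z i \<noteq> 0" by (auto simp: A_def)
    moreover have "\<bar>z i\<bar> \<le> R" for i using z R by (cases "i = k") (auto simp: A_def slice_def abs_le_iff minus_le_iff)
    ultimately show "maxabs z \<in> {1..R}" by (simp add: maxabs_le_iff maxabs_pos_iff)
  qed
  \<comment> \<open>Summation by shells \<open>maxabs z = r\<close>: a shell has
    \<open>O(r ^ (m + 2))\<close> points, hence contributes \<open>O(r ^ m)\<close>, and there are
    \<open>R\<close> shells.\<close>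
  then have "?S = (\<Sum>r\<in>{1..R}. \<Sum>z\<in>{z\<in>A. maxabs z = r}. 1 / (real_of_int (maxabs z))\<^sup>2)"
    unfolding A_def[symmetric] using fA by (intro sum.group[symmetric]) auto
  also have "\<dots> \<le> (\<Sum>r\<in>{1..R}. K * real_of_int R ^ m)"
  proof (rule sum_mono)
    fix r assume r: "r \<in> {1..R}"
    have "{z\<in>A. maxabs z = r} \<subseteq> {z \<in> slice k {-r..r}. maxabs z = r}"
    proof
      fix z assume z: "z \<in> {z\<in>A. maxabs z = r}"
      show "z \<in> {z \<in> slice k {-r..r}. maxabs z = r}"
        using z abs_le_maxabs[of z] by (auto simp: A_def slice_def abs_le_iff minus_le_iff)
    qed
    then have "card {z\<in>A. maxabs z = r} \<le> card {z \<in> slice k {-r..r}. maxabs z = r}"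
      using finite_slice[of "{-r..r}" k] by (intro card_mono) auto
    then have "real (card {z\<in>A. maxabs z = r}) \<le> real (card {z \<in> slice k {-r..r}. maxabs z = r})"
      by (rule of_nat_mono)
    also have "\<dots> \<le> 2 * real CARD('a) * (3 * real_of_int r) ^ (CARD('a) - 2)"
      using r d by (intro card_shell_slice) auto
    finally have c: "real (card {z\<in>A. maxabs z = r}) \<le> K * real_of_int r ^ (m + 2)"
      by (simp add: m K_def power_mult_distrib mult_ac)
    have "(\<Sum>z\<in>{z\<in>A. maxabs z = r}. 1 / (real_of_int (maxabs z))\<^sup>2) = card {z\<in>A. maxabs z = r} / (real_of_int r)\<^sup>2"
      by simp
    also have "\<dots> \<le> (K * real_of_int r ^ (m + 2)) / (real_of_int r)\<^sup>2"
      using c by (intro divide_right_mono) auto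
    also have "\<dots> = K * real_of_int r ^ m" using r by (simp add: power_add power2_eq_square)
    also have "\<dots> \<le> K * real_of_int R ^ m" using r by (intro mult_left_mono power_mono) (auto simp: K_def)
    finally show "(\<Sum>z\<in>{z\<in>A. maxabs z = r}. 1 / (real_of_int (maxabs z))\<^sup>2) \<le> K * real_of_int R ^ m" .
  qed
  also have "\<dots> = K * real_of_int R ^ (m + 1)" using R by simp
  finally show ?thesis by (simp add: m K_def)
qed

text \<open>The hyperplane of a normal \<^term>\<open>h\<close> consists of the points \<^term>\<open>x\<close> with
  \<open>h k * x k = (\<Sum>i\<noteq>k. h i * x i)\<close>: the \<^term>\<open>k\<close>-th entry of a normal counts with negative sign.
  Elsewhere the \<^term>\<open>k\<close>-th coordinate is kept at 0, so that a slice models a space of one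
  dimension less.\<close>

definition cross :: "'a \<Rightarrow> ('a \<Rightarrow> int) \<Rightarrow> ('a \<Rightarrow> int) \<Rightarrow> 'a \<Rightarrow> int" where
  "cross k h h' i = h k * h' i - h' k * h i"

definition normals :: "'a::finite \<Rightarrow> int \<Rightarrow> ('a \<Rightarrow> int) set" where
  "normals k Q = {h. \<forall>i. h i \<in> (if i = k then {Q<..2 * Q} else {1..Q})}"

lemma cross_same [simp]: "cross k h h' k = 0"
  by (simp add: cross_def)

lemma finite_normals: "finite (normals k Q)"
  unfolding normals_def by (rule finite_family) auto

lemma normalsD:
  assumes "h \<in> normals k Q"
  shows "Q < h k" "h k \<le> 2 * Q" "i \<noteq> k \<Longrightarrow> 1 \<le> h i" "i \<noteq> k \<Longrightarrow> h i \<le> Q"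
proof -
  have *: "h i \<in> (if i = k then {Q<..2 * Q} else {1..Q})" for i using assms by (simp add: normals_def)
  show "Q < h k" "h k \<le> 2 * Q" using *[of k] by auto
  show "i \<noteq> k \<Longrightarrow> 1 \<le> h i" "i \<noteq> k \<Longrightarrow> h i \<le> Q" using *[of i] by auto
qed

lemma card_normals: "card (normals (k :: 'a::finite) Q) = nat Q ^ CARD('a)"
proof -
  have "card (normals k Q) = (\<Prod>i\<in>(UNIV :: 'a set). nat Q)"
    unfolding normals_def card_family by (rule prod.cong) auto
  then show ?thesis by simp
qed

text \<open>Up to a remainder below \<open>h k\<close> in each coordinate, the cross vector is
  \<open>h k\<close> times an integer vector \<open>Z h'\<close>, and \<open>h k > Q\<close>. As
  \<open>h' k\<close> and \<open>Z h'\<close> determine \<open>h'\<close>, the sum is at most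
  \<open>Q\<close> times a sum over a slice, which \<open>sum_inverse_square_slice\<close>
  bounds.\<close>

lemma sum_inverse_cross:
  fixes k :: "'a::finite" and Q :: int
  assumes d: "CARD('a) > 3" and Q: "Q \<ge> 1" and h: "h \<in> normals k Q"
    and F: "F \<subseteq> normals k Q" "\<And>h'. h' \<in> F \<Longrightarrow> \<exists>i. cross k h h' i \<noteq> 0"
  shows "(\<Sum>h'\<in>F. Q / maxabs (cross k h h'))
    \<le> (3 ^ CARD('a) + 8 * real CARD('a) * 6 ^ CARD('a)) * real_of_int Q ^ (CARD('a) - 1)"
proof -
  obtain m where m: "CARD('a) = m + 4"
    using d that[of "CARD('a) - 4"] by simp
  define q where "q = h k"
  have q: "Q < q" "q \<le> 2 * Q" using normalsD[OF h] by (auto simp: q_def)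
  \<comment> \<open>This is \<open>h' - (h' k / h k) h\<close> with the subtracted entries rounded
    down.\<close>
  define Z where "Z h' = (\<lambda>i. if i = k then 0 else h' i - (h' k * h i) div q)" for h'
  define S where "S = slice k {-(2*Q)..2*Q}"
  define S1 where "S1 = slice k {-1..1::int}"
  have fS: "finite S" "finite S1" by (simp_all add: S_def S1_def finite_slice)
  \<comment> \<open>A majorant of the summand in terms of \<open>z = Z h'\<close>. The first term
    serves for \<open>z\<close> with entries at most 1 in absolute value, where the cross vector is
    only known to be nonzero; the second serves for all larger \<open>z\<close>.\<close>
  define w :: "('a \<Rightarrow> int) \<Rightarrow> real" where
    "w z = (if z \<in> S1 then real_of_int Q else 0) + (if z = (\<lambda>_. 0) then 0 else 4 * Q * (1 / (real_of_int (maxabs z))\<^sup>2))" for z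
  have w0: "w z \<ge> 0" for z using Q by (simp add: w_def)
  have ZS: "Z h' \<in> S" if h': "h' \<in> F" for h'
  proof -
    have "Z h' i \<in> {-(2*Q)..2*Q}" if i: "i \<noteq> k" for i
    proof -
      have b: "1 \<le> h' i" "h' i \<le> Q" "1 \<le> h i" "h i \<le> Q" "h' k \<le> 2 * Q" "Q < h' k"
        using normalsD[of h' k Q] normalsD[OF h] F h' i by auto
      have "h' k * h i \<le> (2 * Q) * q" using b q Q by (intro mult_mono) auto
      then have "(h' k * h i) div q \<le> ((2 * Q) * q) div q" using q Q by (intro zdiv_mono1) auto
      moreover have "((2 * Q) * q) div q = 2 * Q" using q Q by simp
      moreover have "0 \<le> (h' k * h i) div q" using b q Q by (simp add: pos_imp_zdiv_nonneg_iff)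
      ultimately show ?thesis using i b Q by (simp add: Z_def)
    qed
    then show ?thesis by (auto simp: S_def slice_def) (auto simp: Z_def)
  qed
  have le: "Q / maxabs (cross k h h') \<le> w (Z h')" if h': "h' \<in> F" for h'
  proof -
    have pos: "maxabs (cross k h h') \<ge> 1" using F(2)[OF h'] by (simp add: maxabs_pos_iff)
    obtain j where j: "maxabs (Z h') = \<bar>Z h' j\<bar>" by (rule maxabs_attained)
    show ?thesis
    proof (cases "maxabs (Z h') \<le> 1")
      case True
      then have "Z h' i \<in> {-1..1}" for i using abs_le_maxabs[of "Z h'" i] by (auto simp: abs_le_iff)
      then have "Z h' \<in> S1" by (auto simp: S1_def slice_def) (auto simp: Z_def)
      then have "w (Z h') \<ge> Q" using Q by (auto simp: w_def)
      moreover have "Q / maxabs (cross k h h') \<le> Q" using pos Q by (simp add: field_simps mult_le_cancel_left1)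
      ultimately show ?thesis by linarith
    next
      case False
      define z where "z = Z h' j"
      have z: "\<bar>z\<bar> \<ge> 2" "\<bar>z\<bar> \<le> 2 * Q" using False j abs_le_maxabs ZS[OF h']
        by (auto simp: z_def S_def slice_def abs_le_iff minus_le_iff Z_def split: if_splits)
      have jk: "j \<noteq> k" using z by (auto simp: z_def Z_def)
      have "cross k h h' j = q * z - (h' k * h j) mod q"
        using jk by (simp add: cross_def z_def Z_def q_def algebra_simps minus_div_mult_eq_mod[symmetric])
      moreover have "0 \<le> (h' k * h j) mod q" "(h' k * h j) mod q < q" using q Q by auto
      ultimately have "\<bar>cross k h h' j\<bar> \<ge> q * \<bar>z\<bar> - q" by (simp add: abs_mult[symmetric])
      then have "maxabs (cross k h h') \<ge> q * \<bar>z\<bar> - q" using abs_le_maxabs order_trans by blast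
      \<comment> \<open>As \<open>z\<close> has absolute value at least 2, the remainder costs at
        most half of the main term.\<close>
      moreover have "q * 2 \<le> q * \<bar>z\<bar>" using z q Q by (intro mult_left_mono) auto
      ultimately have "2 * maxabs (cross k h h') \<ge> q * \<bar>z\<bar>" by linarith
      moreover have "q * \<bar>z\<bar> \<ge> Q * \<bar>z\<bar>" using q by (intro mult_right_mono) auto
      ultimately have a: "2 * maxabs (cross k h h') \<ge> Q * \<bar>z\<bar>" by linarith
      \<comment> \<open>One factor of size at most \<open>2 * Q\<close> is given away to reach an
        inverse square, whose sum over the slice still has the right order.\<close>
      have "Q * z\<^sup>2 = (Q * \<bar>z\<bar>) * \<bar>z\<bar>" by (simp add: power2_eq_square)
      also have "\<dots> \<le> (2 * maxabs (cross k h h')) * (2 * Q)" using a z Q pos by (intro mult_mono[OF a z(2)]) linarith+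
      finally have "Q * z\<^sup>2 \<le> 4 * Q * maxabs (cross k h h')" by (simp add: mult_ac)
      then have "real_of_int (Q * z\<^sup>2) \<le> real_of_int (4 * Q * maxabs (cross k h h'))" by (simp only: of_int_le_iff)
      then have "Q / maxabs (cross k h h') \<le> 4 * Q * (1 / (real_of_int z)\<^sup>2)"
        using pos z by (simp add: field_simps)
      also have "\<dots> = 4 * Q * (1 / (real_of_int (maxabs (Z h')))\<^sup>2)" by (simp add: j z_def)
      also have "\<dots> \<le> w (Z h')" using z Q by (auto simp: w_def z_def)
      finally show ?thesis .
    qed
  qed
  have inj: "inj_on (\<lambda>h'. (h' k, Z h')) F"
  proof (rule inj_onI, rule ext)
    fix x y i assume "x \<in> F" "y \<in> F" and e: "(x k, Z x) = (y k, Z y)"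
    then have "Z x i = Z y i" "x k = y k" by auto
    then show "x i = y i" by (cases "i = k") (auto simp: Z_def)
  qed
  have img: "(\<lambda>h'. (h' k, Z h')) ` F \<subseteq> {Q<..2*Q} \<times> S"
    using ZS normalsD(1,2)[OF subsetD[OF F(1)]] by auto
  have "(\<Sum>h'\<in>F. Q / maxabs (cross k h h')) \<le> (\<Sum>h'\<in>F. w (Z h'))"
    by (rule sum_mono) (rule le)
  also have "\<dots> = (\<Sum>(q', z)\<in>(\<lambda>h'. (h' k, Z h')) ` F. w z)"
    by (simp add: sum.reindex[OF inj])
  also have "\<dots> \<le> (\<Sum>(q', z)\<in>{Q<..2*Q} \<times> S. w z)"
    using img fS w0 by (intro sum_mono2) auto
  also have "\<dots> = Q * (\<Sum>z\<in>S. w z)" using Q by (simp add: sum.cartesian_product[symmetric])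
  finally have "(\<Sum>h'\<in>F. Q / maxabs (cross k h h')) \<le> Q * (\<Sum>z\<in>S. w z)" .
  moreover have "(\<Sum>z\<in>S. w z) \<le> 3 ^ (m + 3) * Q + 4 * Q * ((2 * CARD('a) * 3 ^ (m + 2)) * real_of_int (2 * Q) ^ (m + 1))"
  proof -
    have "(\<Sum>z\<in>S. w z) = (\<Sum>z\<in>S. if z \<in> S1 then real_of_int Q else 0)
        + (\<Sum>z\<in>S. if z = (\<lambda>_. 0) then 0 else 4 * Q * (1 / (real_of_int (maxabs z))\<^sup>2))"
      by (simp add: w_def sum.distrib)
    moreover have "(\<Sum>z\<in>S. if z \<in> S1 then real_of_int Q else 0) \<le> 3 ^ (m + 3) * Q"
    proof -
      have "(\<Sum>z\<in>S. if z \<in> S1 then real_of_int Q else 0) \<le> (\<Sum>z\<in>S1. Q)"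
        using fS Q by (subst sum.inter_restrict[symmetric]) (auto intro!: card_mono)
      then show ?thesis by (simp add: S1_def card_slice m add.commute)
    qed
    moreover have "(\<Sum>z\<in>S. if z = (\<lambda>_. 0) then 0 else 4 * Q * (1 / (real_of_int (maxabs z))\<^sup>2))
        \<le> 4 * Q * ((2 * CARD('a) * 3 ^ (m + 2)) * real_of_int (2 * Q) ^ (m + 1))"
    proof -
      have "(\<Sum>z\<in>S. if z = (\<lambda>_. 0) then 0 else 4 * Q * (1 / (real_of_int (maxabs z))\<^sup>2))
          = (\<Sum>z\<in>S - {\<lambda>_. 0}. 4 * Q * (1 / (real_of_int (maxabs z))\<^sup>2))"
        using fS by (intro sum.mono_neutral_cong_right) auto
      also have "\<dots> = 4 * Q * (\<Sum>z\<in>S - {\<lambda>_. 0}. 1 / (real_of_int (maxabs z))\<^sup>2)"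
        by (simp only: sum_distrib_left)
      also have "\<dots> \<le> 4 * Q * ((2 * CARD('a) * 3 ^ (CARD('a) - 2)) * real_of_int (2 * Q) ^ (CARD('a) - 3))"
        unfolding S_def using sum_inverse_square_slice[of "2 * Q" k] d Q by (intro mult_left_mono) auto
      finally show ?thesis by (simp add: m)
    qed
    ultimately show ?thesis by linarith
  qed
  ultimately have "(\<Sum>h'\<in>F. Q / maxabs (cross k h h'))
     \<le> Q * (3 ^ (m + 3) * Q + 4 * Q * ((2 * CARD('a) * 3 ^ (m + 2)) * real_of_int (2 * Q) ^ (m + 1)))"
    using Q by (meson mult_left_mono of_int_0_le_iff order_trans zero_le_one)
  also have "\<dots> = 3 ^ (m + 3) * real_of_int Q ^ 2 + 8 * real CARD('a) * 3 ^ (m + 2) * 2 ^ (m + 1) * real_of_int Q ^ (m + 3)"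
    by (simp add: algebra_simps power_mult_distrib power_add power2_eq_square power3_eq_cube)
  also have "\<dots> \<le> 3 ^ (m + 4) * real_of_int Q ^ (m + 3) + 8 * real CARD('a) * 6 ^ (m + 4) * real_of_int Q ^ (m + 3)"
  proof (rule add_mono)
    show "3 ^ (m + 3) * real_of_int Q ^ 2 \<le> 3 ^ (m + 4) * real_of_int Q ^ (m + 3)"
      using Q by (intro mult_mono power_increasing) auto
    have "(3::real) ^ (m + 2) * 2 ^ (m + 1) \<le> 3 ^ (m + 4) * 2 ^ (m + 4)"
      by (intro mult_mono power_increasing) auto
    also have "\<dots> = 6 ^ (m + 4)" by (simp add: power_mult_distrib[symmetric])
    finally have "8 * real CARD('a) * (3 ^ (m + 2) * 2 ^ (m + 1)) \<le> 8 * real CARD('a) * 6 ^ (m + 4)"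
      by (rule mult_left_mono) auto
    then show "8 * real CARD('a) * 3 ^ (m + 2) * 2 ^ (m + 1) * real_of_int Q ^ (m + 3)
        \<le> 8 * real CARD('a) * 6 ^ (m + 4) * real_of_int Q ^ (m + 3)"
      unfolding mult.assoc[of _ "3 ^ (m + 2)"] using Q by (intro mult_right_mono) auto
  qed
  finally show ?thesis by (simp add: m distrib_right add.commute[of 3 m])
qed

text \<open>Two members of \<open>F\<close> differ by an integer multiple of \<open>e\<close>. Hence
  their entries at a largest coordinate of \<open>e\<close> lie in \<open>{1..Q}\<close>, are
  congruent modulo \<open>maxabs e\<close>, and determine the members.\<close>

lemma card_fibre:
  fixes k :: "'a::finite" and Q q' :: int
  assumes Q: "Q \<ge> 1" and h: "h \<in> normals k Q" and s: "dot e s = 1" and k: "e k = 0"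
    and F: "F \<subseteq> normals k Q" "\<And>h'. h' \<in> F \<Longrightarrow> h' k = q'"
      "\<And>h'. h' \<in> F \<Longrightarrow> cross k h h' = (\<lambda>i. g h' * e i)"
    and e: "1 \<le> maxabs e" "maxabs e \<le> Q"
  shows "real (card F) \<le> 2 * Q / maxabs e"
proof -
  obtain j where j: "maxabs e = \<bar>e j\<bar>" by (rule maxabs_attained)
  then have jk: "j \<noteq> k" using e k by auto
  have q: "h k > 0" using normalsD(1)[OF h] Q by simp
  have par: "\<exists>l. \<forall>i. x i - y i = l * e i" if xy: "x \<in> F" "y \<in> F" for x y
  proof -
    have eq: "h k * (x i - y i) = (g x - g y) * e i" for i
      using fun_cong[OF F(3)[OF xy(1)], of i] fun_cong[OF F(3)[OF xy(2)], of i] F(2)[OF xy(1)] F(2)[OF xy(2)]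
      by (simp add: cross_def algebra_simps)
    \<comment> \<open>Pairing with \<open>s\<close> isolates the scalar \<open>g x - g y\<close> and
      shows that \<open>h k\<close> divides it.\<close>
    define l where "l = dot (\<lambda>i. x i - y i) s"
    have "g x - g y = dot (\<lambda>i. (g x - g y) * e i) s" by (simp add: dot_scale_left s)
    also have "\<dots> = h k * l" unfolding eq[symmetric] l_def by (rule dot_scale_left)
    finally have "h k * (x i - y i) = h k * (l * e i)" for i by (simp only: eq mult.assoc)
    then have "\<forall>i. x i - y i = l * e i" using q by simp
    then show ?thesis by blast
  qed
  have inj: "inj_on (\<lambda>x. x j) F"
  proof (rule inj_onI, rule ext)
    fix x y i assume xy: "x \<in> F" "y \<in> F" "x j = y j"
    from par[OF xy(1,2)] obtain l where l: "\<forall>i. x i - y i = l * e i" ..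
    then have "l * e j = 0" using xy(3) by (metis cancel_comm_monoid_add_class.diff_cancel)
    then have "l = 0" using e j by auto
    then show "x i = y i" using l by simp
  qed
  have "card F = card ((\<lambda>x. x j) ` F)" by (rule card_image[OF inj, symmetric])
  also have "real \<dots> \<le> (Q - 1) / maxabs e + 1"
  proof (rule card_congruent_le)
    show "(\<lambda>x. x j) ` F \<subseteq> {1..Q}" using normalsD(3,4)[OF subsetD[OF F(1)] jk] by auto
    fix a b assume "a \<in> (\<lambda>x. x j) ` F" "b \<in> (\<lambda>x. x j) ` F"
    then obtain x y where "x \<in> F" "y \<in> F" "a = x j" "b = y j" by auto
    then show "maxabs e dvd a - b" using par[of x y] by (auto simp: j)
  qed (use Q e in auto)
  also have "\<dots> = (Q - 1 + maxabs e) / maxabs e" using e by (simp add: field_simps)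
  also have "\<dots> \<le> 2 * Q / maxabs e" using e by (intro divide_right_mono) auto
  finally show ?thesis by simp
qed

text \<open>Normals with \<open>maxabs (E h') > Q\<close> contribute at most \<open>1 / Q\<close>
  each, and there are at most \<open>Q ^ CARD('a)\<close> of them. The others are grouped by
  \<open>h' k\<close> and \<open>E h'\<close>: by \<open>card_fibre\<close> a group contributes at
  most \<open>2 * Q\<close> times the inverse square of \<open>maxabs e\<close>, and
  \<open>sum_inverse_square_slice\<close> applies again.\<close>

lemma sum_inverse_primitive_cross:
  fixes k :: "'a::finite" and Q :: int
  assumes d: "CARD('a) > 3" and Q: "Q \<ge> 1" and h: "h \<in> normals k Q"
    and F: "F \<subseteq> normals k Q"
    and E: "\<And>h'. h' \<in> F \<Longrightarrow> cross k h h' = (\<lambda>i. g h' * E h' i)" "\<And>h'. h' \<in> F \<Longrightarrow> g h' > 0"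
      "\<And>h'. h' \<in> F \<Longrightarrow> dot (E h') (s h') = 1"
  shows "(\<Sum>h'\<in>F. 1 / maxabs (E h'))
    \<le> (1 + 4 * real CARD('a) * 3 ^ CARD('a)) * real_of_int Q ^ (CARD('a) - 1)"
proof -
  obtain m where m: "CARD('a) = m + 4"
    using d that[of "CARD('a) - 4"] by simp
  define S where "S = slice k {-Q..Q} - {\<lambda>_. 0}"
  have fS: "finite S" by (simp add: S_def finite_slice)
  have fF: "finite F" using F finite_normals finite_subset by blast
  have E0: "E h' k = 0" if "h' \<in> F" for h'
    using fun_cong[OF E(1)[OF that], of k] E(2)[OF that] by simp
  have pos: "maxabs (E h') \<ge> 1" if "h' \<in> F" for h'
  proof -
    have "E h' \<noteq> (\<lambda>_. 0)"
    proof
      assume "E h' = (\<lambda>_. 0)"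
      then show False using E(3)[OF that] by (simp add: dot_def)
    qed
    then show ?thesis by (auto simp: maxabs_pos_iff)
  qed
  define F1 where "F1 = {h'\<in>F. maxabs (E h') > Q}"
  define F2 where "F2 = {h'\<in>F. maxabs (E h') \<le> Q}"
  have "F = F1 \<union> F2" "F1 \<inter> F2 = {}" "finite F1" "finite F2" using fF by (auto simp: F1_def F2_def)
  then have "(\<Sum>h'\<in>F. 1 / real_of_int (maxabs (E h')))
      = (\<Sum>h'\<in>F1. 1 / maxabs (E h')) + (\<Sum>h'\<in>F2. 1 / maxabs (E h'))"
    by (simp add: sum.union_disjoint)
  moreover have "(\<Sum>h'\<in>F1. 1 / real_of_int (maxabs (E h'))) \<le> real_of_int Q ^ (m + 3)"
  proof -
    have "(\<Sum>h'\<in>F1. 1 / real_of_int (maxabs (E h'))) \<le> (\<Sum>h'\<in>F1. 1 / real_of_int Q)"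
      using Q by (intro sum_mono divide_left_mono) (auto simp: F1_def)
    also have "\<dots> = card F1 / Q" by simp
    also have "card F1 \<le> nat Q ^ CARD('a)"
      unfolding card_normals[where k = k, symmetric] by (rule card_mono) (use F finite_normals F1_def in auto)
    then have "real (card F1) \<le> real (nat Q ^ CARD('a))" by (rule of_nat_mono)
    then have "card F1 / real_of_int Q \<le> real (nat Q ^ CARD('a)) / Q"
      using Q by (intro divide_right_mono) auto
    also have "\<dots> = real_of_int Q ^ (m + 3)" using Q by (simp add: m power_add power3_eq_cube eval_nat_numeral)
    finally show ?thesis .
  qed
  moreover have "(\<Sum>h'\<in>F2. 1 / real_of_int (maxabs (E h'))) \<le> 4 * real CARD('a) * 3 ^ (m + 2) * real_of_int Q ^ (m + 3)"
  proof -
    have img: "(\<lambda>h'. (h' k, E h')) ` F2 \<subseteq> {Q<..2*Q} \<times> S"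
    proof clarify
      fix h' assume h': "h' \<in> F2"
      then have h'F: "h' \<in> F" by (simp add: F2_def)
      have "\<bar>E h' i\<bar> \<le> Q" for i using abs_le_maxabs[of "E h'" i] h' by (simp add: F2_def)
      then have "E h' \<in> slice k {-Q..Q}" using E0[OF h'F] by (auto simp: slice_def abs_le_iff minus_le_iff)
      moreover have "E h' \<noteq> (\<lambda>_. 0)" using pos[OF h'F] by (auto simp: maxabs_pos_iff)
      ultimately show "h' k \<in> {Q<..2*Q} \<and> E h' \<in> S"
        using normalsD(1,2)[OF subsetD[OF F h'F]] by (simp add: S_def)
    qed
    define G where "G = (\<lambda>p. {h'\<in>F2. (h' k, E h') = p})"
    have "(\<Sum>h'\<in>F2. 1 / real_of_int (maxabs (E h'))) = (\<Sum>p\<in>{Q<..2*Q} \<times> S. \<Sum>h'\<in>G p. 1 / real_of_int (maxabs (E h')))"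
      unfolding G_def using img fS \<open>finite F2\<close> by (intro sum.group[symmetric]) auto
    also have "\<dots> \<le> (\<Sum>(q', e)\<in>{Q<..2*Q} \<times> S. 2 * Q * (1 / (real_of_int (maxabs e))\<^sup>2))"
    proof (rule sum_mono, clarify)
      fix q' e
      show "(\<Sum>h'\<in>G (q', e). 1 / real_of_int (maxabs (E h'))) \<le> 2 * Q * (1 / (real_of_int (maxabs e))\<^sup>2)"
      proof (cases "G (q', e) = {}")
        case True
        then show ?thesis using Q by simp
      next
        case False
        then obtain x where x: "x \<in> F" "E x = e" "maxabs e \<le> Q" by (auto simp: G_def F2_def)
        have "real (card (G (q', e))) \<le> 2 * Q / maxabs e"
        proof (rule card_fibre[OF Q h])
          show "dot e (s x) = 1" "e k = 0" "1 \<le> maxabs e" "maxabs e \<le> Q"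
            using x E(3)[OF x(1)] E0[OF x(1)] pos[OF x(1)] by auto
          show "G (q', e) \<subseteq> normals k Q" using F by (auto simp: G_def F2_def)
          show "h' k = q'" if "h' \<in> G (q', e)" for h' using that by (simp add: G_def)
          show "cross k h h' = (\<lambda>i. g h' * e i)" if "h' \<in> G (q', e)" for h'
            using that E(1)[of h'] by (auto simp: G_def F2_def)
        qed
        moreover have "(\<Sum>h'\<in>G (q', e). 1 / real_of_int (maxabs (E h'))) = card (G (q', e)) * (1 / real_of_int (maxabs e))"
          by (subst sum_constant[symmetric], rule sum.cong) (auto simp: G_def)
        moreover have "card (G (q', e)) * (1 / real_of_int (maxabs e)) \<le> (2 * Q / maxabs e) * (1 / real_of_int (maxabs e))"
          if "real (card (G (q', e))) \<le> 2 * Q / maxabs e"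
          using that pos[OF x(1)] x(2) by (intro mult_right_mono) auto
        ultimately have "(\<Sum>h'\<in>G (q', e). 1 / real_of_int (maxabs (E h'))) \<le> (2 * Q / maxabs e) * (1 / real_of_int (maxabs e))"
          by simp
        then show ?thesis by (simp add: power2_eq_square)
      qed
    qed
    also have "\<dots> = Q * (2 * Q * (\<Sum>e\<in>S. 1 / (real_of_int (maxabs e))\<^sup>2))"
      using Q by (simp add: sum.cartesian_product[symmetric] sum_distrib_left)
    also have "\<dots> \<le> Q * (2 * Q * ((2 * CARD('a) * 3 ^ (CARD('a) - 2)) * real_of_int Q ^ (CARD('a) - 3)))"
      unfolding S_def using sum_inverse_square_slice[of Q k] d Q by (intro mult_left_mono) auto
    also have "\<dots> = 4 * real CARD('a) * 3 ^ (m + 2) * real_of_int Q ^ (m + 3)"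
      by (simp add: m power_add power3_eq_cube)
    finally show ?thesis .
  qed
  moreover have "4 * real CARD('a) * 3 ^ (m + 2) * real_of_int Q ^ (m + 3) \<le> 4 * real CARD('a) * 3 ^ (m + 4) * real_of_int Q ^ (m + 3)"
    using Q by (intro mult_right_mono mult_left_mono power_increasing) auto
  ultimately show ?thesis by (simp add: m distrib_right add.commute[of 3 m])
qed

section \<open>Primitive normals, and representatives of the lattice points of a hyperplane\<close>

definition primitive :: "('a \<Rightarrow> int) \<Rightarrow> bool" where
  "primitive h \<longleftrightarrow> (\<forall>p\<ge>2. \<exists>i. \<not> p dvd h i)"

text \<open>A zero cross vector makes \<open>h\<close> and \<open>h'\<close> proportional.
  Primitivity of \<open>h\<close> makes the factor \<open>l\<close> an integer, and primitivity of
  \<open>h'\<close> forces \<open>l = 1\<close>.\<close>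

lemma cross_nonzero:
  fixes k :: "'a::finite"
  assumes hh: "h \<in> normals k Q" "h' \<in> normals k Q" and Q: "Q \<ge> 1"
    and p: "primitive h" "primitive h'" and ne: "h \<noteq> h'"
  shows "\<exists>i. cross k h h' i \<noteq> 0"
proof (rule ccontr)
  assume "\<nexists>i. cross k h h' i \<noteq> 0"
  then have eq: "h k * h' i = h' k * h i" for i by (auto simp: cross_def)
  have pos: "h k > 0" "h' k > 0" using normalsD(1)[OF hh(1)] normalsD(1)[OF hh(2)] Q by auto
  then obtain g E s where g: "g > 0" "h = (\<lambda>i. g * E i)" "dot E s = 1"
    using primitive_factor[of h k] by auto
  have "\<not> g \<ge> 2" using p(1) g(2) unfolding primitive_def by (metis dvd_triv_left)
  then have "g = 1" using g(1) by simp
  then have s: "dot h s = 1" using g by simp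
  define l where "l = dot h' s"
  have "h k * l = dot (\<lambda>i. h k * h' i) s" by (simp add: l_def dot_scale_left)
  also have "\<dots> = h' k" unfolding eq by (simp add: dot_scale_left s)
  finally have l: "h k * l = h' k" .
  then have l0: "l > 0" using pos by (metis zero_less_mult_pos)
  have "h k * h' i = h k * (l * h i)" for i using eq[of i] l by (metis mult.assoc)
  then have h': "h' i = l * h i" for i using pos by simp
  then have "\<not> l \<ge> 2" using p(2) unfolding primitive_def by (metis dvd_triv_left)
  then have "l = 1" using l0 by simp
  then show False using h' ne by auto
qed

text \<open>Telescoping, with each new term at most \<open>1 / n - 1 / (n + 1)\<close>.\<close>

lemma sum_inverse_squares_le:
  assumes "n \<ge> 1"
  shows "(\<Sum>p\<in>{2..int n}. 1 / (real_of_int p)\<^sup>2) \<le> 1 - 1 / real n"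
  using assms
proof (induction n rule: dec_induct)
  case (step n)
  have "{2..int (Suc n)} = insert (int (Suc n)) {2..int n}" using step by auto
  then have "(\<Sum>p\<in>{2..int (Suc n)}. 1 / (real_of_int p)\<^sup>2)
      = 1 / (real (Suc n))\<^sup>2 + (\<Sum>p\<in>{2..int n}. 1 / (real_of_int p)\<^sup>2)" by simp
  moreover have "1 / (real (Suc n))\<^sup>2 \<le> 1 / (real n * real (Suc n))"
    using step by (intro divide_left_mono) (auto simp: power2_eq_square)
  moreover have "1 / (real n * real (Suc n)) = 1 / real n - 1 / real (Suc n)"
    using step by (simp add: divide_simps)
  ultimately show ?case using step by linarith
qed simp

text \<open>In a normal that is not primitive some \<open>p\<close> between 2 and \<open>Q\<close>
  divides all entries. At most \<open>2 * (Q / p) ^ CARD('a)\<close> normals belong to a given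
  \<open>p\<close>; since the dimension is at least 4, this is at most
  \<open>Q ^ CARD('a) / 2\<close> divided by the square of \<open>p\<close>, and the inverse squares
  sum to at most 1.\<close>

lemma card_primitive_normals:
  fixes k :: "'a::finite" and Q :: int
  assumes d: "CARD('a) > 3" and Q: "Q \<ge> 1"
  shows "real (card {h \<in> normals k Q. primitive h}) \<ge> real_of_int Q ^ CARD('a) / 2"
proof -
  define B where "B p = {h \<in> normals k Q. \<forall>i. p dvd h i}" for p
  have "\<exists>i. i \<noteq> k"
  proof (rule ccontr)
    assume "\<nexists>i. i \<noteq> k"
    then have "(UNIV :: 'a set) = {k}" by auto
    then show False using d by (metis One_nat_def card.empty card_insert_disjoint empty_iff finite.emptyI less_numeral_extra(4) not_numeral_less_one numeral_One)
  qed
  then obtain i0 where i0: "i0 \<noteq> k" ..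
  have fB: "finite (B p)" for p unfolding B_def using finite_normals[of k Q] by simp
  have sub: "normals k Q - {h \<in> normals k Q. primitive h} \<subseteq> (\<Union>p\<in>{2..Q}. B p)"
  proof
    fix h assume "h \<in> normals k Q - {h \<in> normals k Q. primitive h}"
    then have h: "h \<in> normals k Q" "\<not> primitive h" by auto
    then obtain p where p: "p \<ge> 2" "\<forall>i. p dvd h i" by (auto simp: primitive_def)
    then have "p \<le> h i0" using normalsD(3)[OF h(1) i0] by (intro zdvd_imp_le) auto
    then show "h \<in> (\<Union>p\<in>{2..Q}. B p)" using p normalsD(4)[OF h(1) i0] h(1) by (auto simp: B_def intro!: bexI[of _ p])
  qed
  have cB: "real (card (B p)) \<le> (Q ^ CARD('a) / 2) * (1 / (real_of_int p)\<^sup>2)" if p: "p \<in> {2..Q}" for p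
  proof -
    define X where "X i = {x. p dvd x \<and> x \<in> (if i = k then {Q<..2 * Q} else {1..Q})}" for i
    have "B p = {h. \<forall>i. h i \<in> X i}" by (auto simp: B_def normals_def X_def)
    then have "card (B p) = (\<Prod>i\<in>UNIV. card (X i))" by (simp only: card_family)
    then have "real (card (B p)) = (\<Prod>i\<in>UNIV. real (card (X i)))" by simp
    also have "\<dots> \<le> (\<Prod>i\<in>UNIV. if i = k then 2 * Q / real_of_int p else Q / real_of_int p)"
    proof (rule prod_mono)
      fix i :: 'a
      have *: "p dvd x - y" if "x \<in> X i" "y \<in> X i" for x y using that by (auto simp: X_def)
      show "0 \<le> real (card (X i)) \<and> real (card (X i)) \<le> (if i = k then 2 * Q / real_of_int p else Q / real_of_int p)"
      proof (cases "i = k")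
        case True
        \<comment> \<open>The interval need not begin at a multiple of \<open>p\<close>, which costs
          a factor 2 in this one coordinate.\<close>
        have "real (card (X i)) \<le> (2 * Q - (Q + 1)) / p + 1"
          by (rule card_congruent_le) (use * p True in \<open>auto simp: X_def\<close>)
        also have "\<dots> = (Q - 1 + p) / p" using p by (simp add: field_simps)
        also have "\<dots> \<le> 2 * Q / p" using p by (intro divide_right_mono) auto
        finally show ?thesis using True by simp
      next
        case False
        \<comment> \<open>Here the multiples start at \<open>p\<close> itself, so the interval
          shrinks to \<open>{p..Q}\<close> and no factor is lost.\<close>
        have "real (card (X i)) \<le> (Q - p) / p + 1"
          by (rule card_congruent_le) (use * p False in \<open>auto simp: X_def zdvd_imp_le\<close>)
        also have "\<dots> = Q / p" using p by (simp add: field_simps)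
        finally show ?thesis using False by simp
      qed
    qed
    also have "\<dots> = (2 * Q / real_of_int p) * (Q / real_of_int p) ^ (CARD('a) - 1)" by (rule prod_except_one)
    also have "\<dots> = 2 * (Q / real_of_int p) ^ CARD('a)" using d by (cases "CARD('a)") simp_all
    also have "\<dots> = 2 * Q ^ CARD('a) * (1 / real_of_int p ^ CARD('a))" by (simp add: power_divide)
    also have "\<dots> \<le> 2 * Q ^ CARD('a) * (1 / (4 * real_of_int p ^ 2))"
    proof -
      have "4 * real_of_int p ^ 2 \<le> real_of_int p ^ 2 * real_of_int p ^ 2"
        using p power_mono[of 2 "real_of_int p" 2] by (intro mult_right_mono) auto
      also have "\<dots> = real_of_int p ^ 4" by (simp add: power_add[symmetric])
      also have "\<dots> \<le> real_of_int p ^ CARD('a)" using d p by (intro power_increasing) auto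
      finally show ?thesis using p Q by (intro mult_left_mono divide_left_mono) auto
    qed
    finally show ?thesis by (simp add: field_simps)
  qed
  have "card (normals k Q - {h \<in> normals k Q. primitive h}) \<le> card (\<Union>p\<in>{2..Q}. B p)"
    using sub fB by (intro card_mono) auto
  also have "\<dots> \<le> (\<Sum>p\<in>{2..Q}. card (B p))" by (rule card_UN_le) auto
  finally have "real (card (normals k Q - {h \<in> normals k Q. primitive h})) \<le> real (\<Sum>p\<in>{2..Q}. card (B p))"
    by (rule of_nat_mono)
  also have "\<dots> \<le> (\<Sum>p\<in>{2..Q}. (Q ^ CARD('a) / 2) * (1 / (real_of_int p)\<^sup>2))"
    unfolding of_nat_sum by (rule sum_mono) (rule cB)
  also have "\<dots> = (Q ^ CARD('a) / 2) * (\<Sum>p\<in>{2..Q}. 1 / (real_of_int p)\<^sup>2)" by (simp only: sum_distrib_left)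
  also have "\<dots> \<le> (Q ^ CARD('a) / 2) * 1"
  proof (rule mult_left_mono)
    have "(\<Sum>p\<in>{2..int (nat Q)}. 1 / (real_of_int p)\<^sup>2) \<le> 1 - 1 / real (nat Q)"
      using Q by (intro sum_inverse_squares_le) auto
    also have "\<dots> \<le> 1" using Q by simp
    finally show "(\<Sum>p\<in>{2..Q}. 1 / (real_of_int p)\<^sup>2) \<le> 1" using Q by simp
  qed (use Q in simp)
  finally have "real (card (normals k Q - {h \<in> normals k Q. primitive h})) \<le> Q ^ CARD('a) / 2" by simp
  moreover have "card (normals k Q - {h \<in> normals k Q. primitive h})
      = card (normals k Q) - card {h \<in> normals k Q. primitive h}"
    using finite_normals[of k Q] by (intro card_Diff_subset) auto
  moreover have "real (card (normals k Q)) = real_of_int Q ^ CARD('a)" using Q by (simp add: card_normals)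
  moreover have "card {h \<in> normals k Q. primitive h} \<le> card (normals k Q)"
    using finite_normals by (intro card_mono) auto
  ultimately show ?thesis by (simp add: of_nat_diff field_simps)
qed

text \<open>Pigeonhole: the \<open>q ^ (CARD('a) - 1)\<close> vectors with entries in
  \<open>{0..<q}\<close> fall into \<open>q\<close> classes by the residue of
  \<open>dot h u\<close>. Subtracting a fixed member from a largest class makes the residue 0. The
  vectors stay distinct modulo \<open>q\<close>, so adding multiples of \<open>q\<close> to them
  yields disjoint classes.\<close>

lemma many_kernel_vectors:
  fixes k :: "'a::finite" and q :: int
  assumes d: "CARD('a) > 1" and q: "q \<ge> 1"
  obtains U where "U \<subseteq> slice k {-q<..<q}" "finite U" "real (card U) \<ge> q ^ (CARD('a) - 2)"
    "\<And>u. u \<in> U \<Longrightarrow> q dvd dot h u"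
    "\<And>u v. u \<in> U \<Longrightarrow> v \<in> U \<Longrightarrow> (\<forall>i. q dvd u i - v i) \<Longrightarrow> u = v"
proof -
  define B where "B = slice k {0..<q}"
  define G where "G e = {u \<in> B. dot h u mod q = e}" for e
  have fB: "finite B" by (simp add: B_def finite_slice)
  have fG: "finite (G e)" for e using fB by (simp add: G_def)
  have "\<exists>e\<in>{0..<q}. card (G e) \<ge> nat q ^ (CARD('a) - 2)"
  proof (rule ccontr)
    assume "\<not> ?thesis"
    then have less: "card (G e) < nat q ^ (CARD('a) - 2)" if "e \<in> {0..<q}" for e
      using that by (meson not_le)
    have "card B = (\<Sum>e\<in>{0..<q}. card (G e))"
      using sum.group[OF fB, of "{0..<q}" "\<lambda>u. dot h u mod q" "\<lambda>_. 1 :: nat"] q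
      by (auto simp: G_def image_subset_iff)
    also have "\<dots> < (\<Sum>e\<in>{0..<q}. nat q ^ (CARD('a) - 2))" using less q by (intro sum_strict_mono) auto
    also have "\<dots> = nat q ^ (CARD('a) - 1)" using d
      by (simp add: power_Suc[symmetric] Suc_diff_Suc numeral_2_eq_2 del: power_Suc)
    finally show False by (simp add: B_def card_slice)
  qed
  then obtain e where e: "card (G e) \<ge> nat q ^ (CARD('a) - 2)" by auto
  then have "card (G e) > 0" using q by (metis less_le_trans zero_less_nat_eq zero_less_power int_one_le_iff_zero_less)
  then obtain r where r: "r \<in> G e" by (metis card_gt_0_iff ex_in_conv)
  define U where "U = (\<lambda>u i. u i - r i) ` G e"
  have inj: "inj_on (\<lambda>u i. u i - r i) (G e)"
  proof (rule inj_onI, rule ext)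
    fix x y i assume "(\<lambda>i. x i - r i) = (\<lambda>i. y i - r i)"
    from fun_cong[OF this, of i] show "x i = y i" by simp
  qed
  show ?thesis
  proof (rule that[of U])
    show "U \<subseteq> slice k {-q<..<q}"
    proof
      fix u assume "u \<in> U"
      then obtain v where v: "v \<in> B" "u = (\<lambda>i. v i - r i)" by (auto simp: U_def G_def)
      have "-q < v i - r i \<and> v i - r i < q" if "i \<noteq> k" for i
      proof -
        have "0 \<le> v i" "v i < q" "0 \<le> r i" "r i < q" using v(1) r that by (auto simp: B_def G_def slice_def)
        then show ?thesis by linarith
      qed
      then show "u \<in> slice k {-q<..<q}" using v r by (auto simp: slice_def B_def G_def)
    qed
    show "finite U" using fG by (simp add: U_def)
    have "card U = card (G e)" unfolding U_def by (rule card_image[OF inj])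
    then have "real (card U) \<ge> real (nat q ^ (CARD('a) - 2))" using e by (simp only: of_nat_le_iff)
    then show "real (card U) \<ge> q ^ (CARD('a) - 2)" using q by simp
    show "q dvd dot h u" if u: "u \<in> U" for u
    proof -
      obtain v where "v \<in> G e" "u = (\<lambda>i. v i - r i)" using u unfolding U_def image_iff by blast
      then show ?thesis using r by (simp add: dot_diff_right G_def mod_eq_dvd_iff[symmetric])
    qed
    show "u = v" if uv: "u \<in> U" "v \<in> U" and c: "\<forall>i. q dvd u i - v i" for u v
    proof -
      obtain u' v' where u': "u' \<in> B" "v' \<in> B" and e: "u = (\<lambda>i. u' i - r i)" "v = (\<lambda>i. v' i - r i)"
        using uv by (auto simp: U_def G_def)
      have "u' i = v' i" for i
      proof (cases "i = k")
        case False
        have "u' i mod q = v' i mod q" using c e by (simp add: mod_eq_dvd_iff)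
        then show ?thesis using u' False by (simp add: B_def slice_def)
      qed (use u' in \<open>simp add: B_def slice_def\<close>)
      then show ?thesis by (simp add: e)
    qed
  qed
qed

section \<open>Lattice points that are not just above another hyperplane\<close>

lemma maxabs_scale:
  assumes "g > 0"
  shows "maxabs (\<lambda>i. g * E i) = g * maxabs E"
proof (rule antisym)
  show "maxabs (\<lambda>i. g * E i) \<le> g * maxabs E"
    using assms by (simp add: maxabs_le_iff abs_mult abs_le_maxabs)
  obtain j where "maxabs E = \<bar>E j\<bar>" by (rule maxabs_attained)
  then show "g * maxabs E \<le> maxabs (\<lambda>i. g * E i)"
    using abs_le_maxabs[of "\<lambda>i. g * E i" j] assms by (simp add: abs_mult)
qed

text \<open>The value of the form of \<^term>\<open>h'\<close> at the point of the hyperplane of \<^term>\<open>h\<close> whose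
  coordinates other than \<^term>\<open>k\<close> are those of \<^term>\<open>u\<close>; only meaningful if
  \<^term>\<open>h k dvd dot h u\<close>.\<close>

definition level :: "'a::finite \<Rightarrow> ('a \<Rightarrow> int) \<Rightarrow> ('a \<Rightarrow> int) \<Rightarrow> ('a \<Rightarrow> int) \<Rightarrow> int" where
  "level k h h' u = dot h' u - h' k * (dot h u div h k)"

text \<open>Lattice points of the hyperplane of \<open>h\<close>, recorded without their coordinate
  \<open>k\<close>. For \<open>T \<ge> 2\<close> the ends of the window differ by a factor of at
  most 8, and avoiding \<open>{0..W}\<close> means not lying just above another hyperplane.\<close>

definition good :: "'a::finite \<Rightarrow> int \<Rightarrow> int \<Rightarrow> int \<Rightarrow> ('a \<Rightarrow> int) \<Rightarrow> ('a \<Rightarrow> int) set" where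
  "good k Q T W h = {u \<in> slice k {Q * (T - 1)<..<4 * Q * T}. h k dvd dot h u \<and>
     (\<forall>h'\<in>normals k Q. primitive h' \<longrightarrow> h' \<noteq> h \<longrightarrow> level k h h' u \<notin> {0..W})}"

text \<open>A step by \<open>h k * t\<close> keeps the point on the hyperplane of \<open>h\<close>
  and integral, whatever \<open>t\<close> is. So on such a class the level is affine in a free
  vector, as \<open>card_slab_slice\<close> requires.\<close>

lemma level_shift:
  assumes "h k dvd dot h b" "h k \<noteq> 0"
  shows "level k h h' (\<lambda>i. b i + h k * t i) = level k h h' b + dot (cross k h h') t"
proof -
  have "(dot h b + h k * dot h t) div h k = dot h b div h k + dot h t"
    using assms by simp
  moreover have "dot (cross k h h') t = h k * dot h' t - h' k * dot h t"
    by (simp add: dot_def cross_def algebra_simps sum_subtractf sum_distrib_left)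
  ultimately show ?thesis
    by (simp add: level_def dot_add_right dot_scale_right algebra_simps)
qed

text \<open>The parenthesis collects the constants of \<open>sum_inverse_cross\<close> and
  \<open>sum_inverse_primitive_cross\<close>. The power of 2 absorbs the factor
  \<open>2 ^ (CARD('a) - 2)\<close> of \<open>card_slab_slice\<close> and leaves a further factor 2,
  so that at most half of the vectors are bad.\<close>

definition scale_const :: "'a::finite itself \<Rightarrow> int \<Rightarrow> int" where
  "scale_const _ C = 2 ^ (CARD('a) - 1) *
    (C * (3 ^ CARD('a) + 8 * int CARD('a) * 6 ^ CARD('a)) + (1 + 4 * int CARD('a) * 3 ^ CARD('a)))"

lemma maxabs_cross_le:
  assumes "h \<in> normals k Q" "h' \<in> normals k Q" and Q: "Q \<ge> 1"
  shows "maxabs (cross k h h') \<le> 2 * Q\<^sup>2"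
  unfolding maxabs_le_iff
proof
  fix i
  show "\<bar>cross k h h' i\<bar> \<le> 2 * Q\<^sup>2"
  proof (cases "i = k")
    case False
    note b = normalsD[OF assms(1)] normalsD[OF assms(2)]
    have "h k * h' i \<le> (2 * Q) * Q" "h' k * h i \<le> (2 * Q) * Q"
      using b b(3,4,7,8)[OF False] Q by (auto intro!: mult_mono)
    moreover have "0 \<le> h k * h' i" "0 \<le> h' k * h i"
      using b(1,5) b(3,4,7,8)[OF False] Q by auto
    ultimately show ?thesis by (simp add: cross_def power2_eq_square)
  qed simp
qed

text \<open>Factoring each cross vector as \<open>g\<close> times a primitive \<open>E\<close>,
  \<open>card_slab_slice\<close> and the two sums over normals give a total of order
  \<open>Q ^ (CARD('a) - 1) * T ^ (CARD('a) - 2)\<close>, and \<open>T\<close> is large against the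
  power of \<open>Q\<close>. The offsets \<open>c h'\<close> are arbitrary, so the bound holds for
  every class.\<close>

lemma sum_card_bad_le:
  fixes k :: "'a::finite" and Q C T :: int
  assumes d: "CARD('a) > 3" and Q: "Q \<ge> 1" and C: "C \<ge> 0"
    and h: "h \<in> normals k Q" "primitive h"
    and T: "T \<ge> scale_const TYPE('a) C * Q ^ (CARD('a) - 1)"
  shows "(\<Sum>h'\<in>{h'\<in>normals k Q. primitive h' \<and> h' \<noteq> h}.
      real (card {t \<in> slice k {0..<T}. c h' + dot (cross k h h') t \<in> {0..C * Q}}))
    \<le> real_of_int T ^ (CARD('a) - 1) / 2"
proof -
  define F where "F = {h'\<in>normals k Q. primitive h' \<and> h' \<noteq> h}"
  define K1 K2 where "K1 = 3 ^ CARD('a) + 8 * real CARD('a) * 6 ^ CARD('a)"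
    and "K2 = 1 + 4 * real CARD('a) * 3 ^ CARD('a)"
  define m where "m = CARD('a) - 2"
  have m: "CARD('a) - 1 = Suc m" "CARD('a) - 2 = m" "m \<ge> 1" using d by (auto simp: m_def)
  have K: "K1 \<ge> 0" "K2 \<ge> 1" by (auto simp: K1_def K2_def)
  have T': "real_of_int T \<ge> 2 ^ Suc m * (C * K1 + K2) * real_of_int Q ^ Suc m"
  proof -
    have "real_of_int (scale_const TYPE('a) C * Q ^ (CARD('a) - 1)) \<le> real_of_int T" using T by (simp only: of_int_le_iff)
    then show ?thesis unfolding scale_const_def m(1) K1_def K2_def by simp
  qed
  \<comment> \<open>By \<open>maxabs_cross_le\<close> this gives
    \<open>maxabs (E h') \<le> T\<close>, which \<open>card_slab_slice\<close> needs.\<close>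
  have TQ: "T \<ge> 2 * Q\<^sup>2"
  proof -
    have "2 * real_of_int Q ^ 2 \<le> 2 ^ Suc m * real_of_int Q ^ Suc m"
      using Q m by (intro mult_mono power_increasing self_le_power) auto
    also have "\<dots> \<le> (2 ^ Suc m * real_of_int Q ^ Suc m) * (C * K1 + K2)"
    proof -
      have "C * K1 + K2 \<ge> 1" using K C by (simp add: add_increasing)
      then show ?thesis
        using mult_left_mono[of 1 "C * K1 + K2" "2 ^ Suc m * real_of_int Q ^ Suc m"] Q by simp
    qed
    also have "\<dots> \<le> T" using T' by (simp add: mult_ac)
    finally have "real_of_int (2 * Q\<^sup>2) \<le> real_of_int T" by simp
    then show ?thesis by (simp only: of_int_le_iff)
  qed
  then have T0: "0 \<le> T" by (rule order_trans[rotated]) simp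
  have nz: "\<exists>i. cross k h h' i \<noteq> 0" if "h' \<in> F" for h'
    using cross_nonzero[of h k Q h'] h that Q by (auto simp: F_def)
  have "\<exists>g E s. g > 0 \<and> cross k h h' = (\<lambda>i. g * E i) \<and> dot E s = 1" if "h' \<in> F" for h'
    using nz[OF that] primitive_factor by metis
  then obtain g E s where gE: "\<And>h'. h' \<in> F \<Longrightarrow> g h' > 0"
    "\<And>h'. h' \<in> F \<Longrightarrow> cross k h h' = (\<lambda>i. g h' * E h' i)" "\<And>h'. h' \<in> F \<Longrightarrow> dot (E h') (s h') = 1"
    by metis
  have le: "real (card {t \<in> slice k {0..<T}. c h' + dot (cross k h h') t \<in> {0..C * Q}})
      \<le> (C * (Q / maxabs (cross k h h')) + 1 / maxabs (E h')) * (2 * real_of_int T) ^ m" if h': "h' \<in> F" for h'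
  proof -
    have mx: "maxabs (cross k h h') = g h' * maxabs (E h')" using gE(1,2)[OF h'] by (simp add: maxabs_scale)
    have Ek: "E h' k = 0" using fun_cong[OF gE(2)[OF h'], of k] gE(1)[OF h'] by simp
    have ET: "maxabs (E h') \<le> T"
    proof -
      have "0 \<le> maxabs (E h')" using abs_le_maxabs[of "E h'" k] by linarith
      then have "maxabs (E h') \<le> g h' * maxabs (E h')" using gE(1)[OF h'] by (simp add: mult_le_cancel_right1)
      also have "\<dots> \<le> 2 * Q\<^sup>2" unfolding mx[symmetric] using h h' Q by (intro maxabs_cross_le) (auto simp: F_def)
      finally show ?thesis using TQ by simp
    qed
    show ?thesis
      using card_slab_slice[OF gE(3)[OF h'] Ek gE(1)[OF h'] _ ET, of "C * Q" "c h'"] C Q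
      unfolding mx by (simp add: gE(2)[OF h', symmetric] m(2))
  qed
  have "(\<Sum>h'\<in>F. real (card {t \<in> slice k {0..<T}. c h' + dot (cross k h h') t \<in> {0..C * Q}}))
      \<le> (\<Sum>h'\<in>F. (C * (Q / maxabs (cross k h h')) + 1 / maxabs (E h')) * (2 * real_of_int T) ^ m)"
    by (rule sum_mono) (rule le)
  also have "\<dots> = (C * (\<Sum>h'\<in>F. Q / maxabs (cross k h h')) + (\<Sum>h'\<in>F. 1 / maxabs (E h'))) * (2 * real_of_int T) ^ m"
    by (simp only: sum_distrib_right[symmetric] sum.distrib sum_distrib_left)
  also have "\<dots> \<le> (C * (K1 * real_of_int Q ^ Suc m) + K2 * real_of_int Q ^ Suc m) * (2 * real_of_int T) ^ m"
  proof (intro mult_right_mono add_mono mult_left_mono)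
    show "(\<Sum>h'\<in>F. Q / real_of_int (maxabs (cross k h h'))) \<le> K1 * real_of_int Q ^ Suc m"
      unfolding K1_def m(1)[symmetric] using nz by (intro sum_inverse_cross[OF d Q h(1)]) (auto simp: F_def)
    show "(\<Sum>h'\<in>F. 1 / real_of_int (maxabs (E h'))) \<le> K2 * real_of_int Q ^ Suc m"
      unfolding K2_def m(1)[symmetric]
      using gE by (intro sum_inverse_primitive_cross[OF d Q h(1), of F g E s]) (auto simp: F_def)
  qed (use C T0 in auto)
  also have "\<dots> = (2 ^ Suc m * (C * K1 + K2) * real_of_int Q ^ Suc m) * real_of_int T ^ m / 2"
    by (simp add: power_mult_distrib algebra_simps)
  also have "\<dots> \<le> real_of_int T * real_of_int T ^ m / 2"
    using T' T0 by (intro divide_right_mono mult_right_mono) auto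
  finally show ?thesis unfolding F_def m(1) power_Suc .
qed

text \<open>Each kernel vector \<open>u\<close> starts a class \<open>b u + q * t\<close> of lattice
  points. In each class at least half of the \<open>T ^ (CARD('a) - 1)\<close> vectors
  \<open>t\<close> avoid all bad levels.\<close>

lemma card_good_ge:
  fixes k :: "'a::finite" and Q C T :: int
  assumes d: "CARD('a) > 3" and Q: "Q \<ge> 1" and C: "C \<ge> 0"
    and h: "h \<in> normals k Q" "primitive h"
    and T: "T \<ge> scale_const TYPE('a) C * Q ^ (CARD('a) - 1)" "T \<ge> 1"
  shows "real (card (good k Q T (C * Q) h))
    \<ge> real_of_int Q ^ (CARD('a) - 2) * real_of_int T ^ (CARD('a) - 1) / 2"
proof -
  define q where "q = h k"
  have q: "Q < q" "q \<le> 2 * Q" using normalsD(1,2)[OF h(1)] by (simp_all add: q_def)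
  then have q1: "q \<ge> 1" using Q by simp
  have "CARD('a) > 1" using d by simp
  then obtain U where U: "U \<subseteq> slice k {-q<..<q}" "finite U" "real (card U) \<ge> real_of_int (q ^ (CARD('a) - 2))"
    "\<And>u. u \<in> U \<Longrightarrow> q dvd dot h u"
    "\<And>u v. u \<in> U \<Longrightarrow> v \<in> U \<Longrightarrow> (\<forall>i. q dvd u i - v i) \<Longrightarrow> u = v"
    using many_kernel_vectors[of q k h] q1 by metis
  define F where "F = {h'\<in>normals k Q. primitive h' \<and> h' \<noteq> h}"
  have fF: "finite F" using finite_normals[of k Q] by (simp add: F_def)
  \<comment> \<open>The shift by \<open>q * T\<close> moves the class away from the origin: as the
    entries of \<open>u\<close> exceed \<open>-q\<close>, the sums exceed
    \<open>q * (T - 1) \<ge> Q * (T - 1)\<close>.\<close>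
  define b where "b u i = (if i = k then 0 else u i + q * T)" for u :: "'a \<Rightarrow> int" and i
  define bad where "bad u h' = {t \<in> slice k {0..<T}. level k h h' (b u) + dot (cross k h h') t \<in> {0..C * Q}}" for u h'
  define G where "G u = slice k {0..<T} - (\<Union>h'\<in>F. bad u h')" for u
  define \<psi> where "\<psi> = (\<lambda>(u, t) i. b u i + q * t i)"
  have fs: "finite (slice k {0..<T})" by (simp add: finite_slice)
  have cG: "real (card (G u)) \<ge> real_of_int T ^ (CARD('a) - 1) / 2" for u
  proof -
    have sub: "(\<Union>h'\<in>F. bad u h') \<subseteq> slice k {0..<T}" by (auto simp: bad_def)
    have "card (\<Union>h'\<in>F. bad u h') \<le> (\<Sum>h'\<in>F. card (bad u h'))" using fF by (rule card_UN_le)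
    then have "real (card (\<Union>h'\<in>F. bad u h')) \<le> real (\<Sum>h'\<in>F. card (bad u h'))" by (rule of_nat_mono)
    also have "\<dots> \<le> real_of_int T ^ (CARD('a) - 1) / 2"
      unfolding of_nat_sum bad_def F_def by (rule sum_card_bad_le) fact+
    finally have "real (card (\<Union>h'\<in>F. bad u h')) \<le> real_of_int T ^ (CARD('a) - 1) / 2" .
    moreover have "card (G u) = card (slice k {0..<T}) - card (\<Union>h'\<in>F. bad u h')"
      unfolding G_def using sub fs by (intro card_Diff_subset) (auto dest: finite_subset)
    moreover have "card (\<Union>h'\<in>F. bad u h') \<le> card (slice k {0..<T})" using sub fs by (intro card_mono)
    moreover have "real (card (slice k {0..<T})) = real_of_int T ^ (CARD('a) - 1)"
      using T by (simp add: card_slice)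
    ultimately show ?thesis by (simp add: of_nat_diff)
  qed
  have dvd: "q dvd dot h (b u)" if "u \<in> U" for u
  proof -
    have "dot h (b u) = dot h u + q * (T * dot h (\<lambda>i. if i = k then 0 else 1))"
    proof -
      have "b u = (\<lambda>i. u i + (q * T) * (if i = k then 0 else 1))"
      proof
        fix i
        have "u k = 0" using that U(1) by (auto simp: slice_def)
        then show "b u i = u i + (q * T) * (if i = k then 0 else 1)" by (simp add: b_def)
      qed
      then show ?thesis by (simp only: dot_add_right dot_scale_right mult.assoc)
    qed
    then show ?thesis using U(4)[OF that] by simp
  qed
  have img: "\<psi> ` (SIGMA u:U. G u) \<subseteq> good k Q T (C * Q) h"
  proof clarify
    fix u t assume u: "u \<in> U" and t: "t \<in> G u"
    have ts: "t \<in> slice k {0..<T}" using t by (simp add: G_def)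
    have "\<psi> (u, t) i \<in> {Q * (T - 1)<..<4 * Q * T}" if i: "i \<noteq> k" for i
    proof -
      have r: "-q < u i" "u i < q" "0 \<le> t i" "t i + 1 \<le> T" using u U(1) ts i by (auto simp: slice_def)
      have "\<psi> (u, t) i = u i + q * T + q * t i" using i by (simp add: \<psi>_def b_def)
      moreover have "0 \<le> q * t i" using r q1 by simp
      moreover have "q * t i + q \<le> q * T"
        using mult_left_mono[OF r(4), of q] q1 by (simp add: distrib_left)
      moreover have "q * T \<le> 2 * (Q * T)" using mult_right_mono[OF q(2), of T] T by simp
      moreover have "Q * T - Q \<le> q * T - q"
        using mult_right_mono[of Q q "T - 1"] q T by (simp add: right_diff_distrib)
      ultimately have "Q * T - Q < \<psi> (u, t) i" "\<psi> (u, t) i < 4 * (Q * T)" using r by linarith+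
      then show ?thesis by (simp add: right_diff_distrib)
    qed
    then have "\<psi> (u, t) \<in> slice k {Q * (T - 1)<..<4 * Q * T}"
      using ts by (auto simp: slice_def) (auto simp: \<psi>_def b_def)
    moreover have "h k dvd dot h (\<psi> (u, t))"
      using dvd[OF u] by (simp add: \<psi>_def dot_add_right dot_scale_right q_def)
    moreover have "level k h h' (\<psi> (u, t)) \<notin> {0..C * Q}" if h': "h' \<in> F" for h'
    proof -
      have "level k h h' (\<psi> (u, t)) = level k h h' (b u) + dot (cross k h h') t"
        using level_shift[of h k "b u" h' t] dvd[OF u] q1 by (simp add: \<psi>_def q_def)
      moreover have "t \<notin> bad u h'" using t h' by (simp add: G_def)
      ultimately show ?thesis using ts by (simp add: bad_def)
    qed
    ultimately show "\<psi> (u, t) \<in> good k Q T (C * Q) h" by (auto simp: good_def F_def)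
  qed
  have inj: "inj_on \<psi> (SIGMA u:U. G u)"
  proof (rule inj_onI, clarify)
    fix u t u' t' assume u: "u \<in> U" "u' \<in> U" and t: "t \<in> G u" "t' \<in> G u'"
      and e: "\<psi> (u, t) = \<psi> (u', t')"
    have tk: "t k = t' k" "u k = u' k" using t subsetD[OF U(1) u(1)] subsetD[OF U(1) u(2)] by (auto simp: G_def slice_def)
    \<comment> \<open>Equal images force \<open>u\<close> and \<open>u'\<close> to agree modulo
      \<open>q\<close>, hence to be equal.\<close>
    have eq: "u i - u' i = q * (t' i - t i)" for i
      using fun_cong[OF e, of i] tk by (cases "i = k") (auto simp: \<psi>_def b_def algebra_simps)
    then have "u = u'" using u by (intro U(5)) auto
    moreover have "t = t'"
    proof
      fix i
      show "t i = t' i" using eq[of i] \<open>u = u'\<close> q1 by auto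
    qed
    ultimately show "u = u' \<and> t = t'" by simp
  qed
  have "finite (good k Q T (C * Q) h)"
    by (rule finite_subset[OF _ finite_slice[of "{Q * (T - 1)<..<4 * Q * T}" k]]) (auto simp: good_def)
  then have "card (SIGMA u:U. G u) \<le> card (good k Q T (C * Q) h)"
    using img inj by (intro card_inj_on_le)
  moreover have "card (SIGMA u:U. G u) = (\<Sum>u\<in>U. card (G u))"
    using U(2) fs by (intro card_SigmaI) (auto simp: G_def)
  ultimately have "real (card (good k Q T (C * Q) h)) \<ge> (\<Sum>u\<in>U. real (card (G u)))"
    by (metis of_nat_le_iff of_nat_sum)
  moreover have "(\<Sum>u\<in>U. real (card (G u))) \<ge> (\<Sum>u\<in>U. real_of_int T ^ (CARD('a) - 1) / 2)"
    by (rule sum_mono) (rule cG)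
  moreover have "(\<Sum>u\<in>U. real_of_int T ^ (CARD('a) - 1) / 2) = card U * (real_of_int T ^ (CARD('a) - 1) / 2)"
    by simp
  moreover have "real (card U) \<ge> real_of_int Q ^ (CARD('a) - 2)"
  proof -
    have "real_of_int Q ^ (CARD('a) - 2) \<le> real_of_int q ^ (CARD('a) - 2)"
      using q Q by (intro power_mono) auto
    then show ?thesis using U(3) by simp
  qed
  then have "real_of_int Q ^ (CARD('a) - 2) * (real_of_int T ^ (CARD('a) - 1) / 2)
      \<le> card U * (real_of_int T ^ (CARD('a) - 1) / 2)"
    using T by (intro mult_right_mono) auto
  ultimately show ?thesis by simp
qed

section \<open>The configuration\<close>

text \<open>The cube with vertex \<^term>\<open>v\<close> that extends downwards in direction \<^term>\<open>k\<close> and upwards in all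
  the others.\<close>

definition cube_at :: "'a \<Rightarrow> ('a::finite \<Rightarrow> int) \<Rightarrow> (real ^ 'a) set" where
  "cube_at k v = unit_hypercube (\<chi> i. nat (if i = k then v i - 1 else v i))"

text \<open>Solves the equation of the hyperplane of \<open>h\<close> for coordinate
  \<open>k\<close>; on \<open>good\<close> the quotient is exact.\<close>

definition lift :: "'a::finite \<Rightarrow> ('a \<Rightarrow> int) \<Rightarrow> ('a \<Rightarrow> int) \<Rightarrow> 'a \<Rightarrow> int" where
  "lift k h u = u(k := dot h u div h k)"

definition form :: "'a::finite \<Rightarrow> ('a \<Rightarrow> int) \<Rightarrow> ('a \<Rightarrow> real) \<Rightarrow> real" where
  "form k h y = (\<Sum>i\<in>UNIV. (if i = k then - real_of_int (h i) else real_of_int (h i)) * y i)"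

lemma form_lift:
  assumes "u k = 0"
  shows "form k h' (\<lambda>i. real_of_int (lift k h u i)) = real_of_int (level k h h' u)"
proof -
  have "form k h' (\<lambda>i. real_of_int (lift k h u i))
      = real_of_int (\<Sum>i\<in>UNIV. (if i = k then - h' i else h' i) * lift k h u i)"
    unfolding form_def of_int_sum by (rule sum.cong) auto
  also have "(\<Sum>i\<in>UNIV. (if i = k then - h' i else h' i) * lift k h u i)
      = - h' k * (dot h u div h k) + (\<Sum>i\<in>UNIV - {k}. h' i * u i)"
    by (subst sum.remove[of _ k]) (auto simp: lift_def intro!: sum.cong)
  also have "(\<Sum>i\<in>UNIV - {k}. h' i * u i) = dot h' u"
    unfolding dot_def using assms by (subst (2) sum.remove[of _ k]) auto
  finally show ?thesis by (simp add: level_def)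
qed

lemma level_self:
  assumes "h k dvd dot h u"
  shows "level k h h u = 0"
  using assms by (simp add: level_def)

lemma lift_eqD:
  assumes "lift k h u = lift k h' u'" "u k = 0" "u' k = 0"
  shows "u = u'"
proof
  fix i
  show "u i = u' i" using fun_cong[OF assms(1), of i] assms(2,3) by (cases "i = k") (auto simp: lift_def)
qed

section \<open>Unit cubes and the values of the linear forms on them\<close>

lemma mem_unit_hypercube:
  "y \<in> unit_hypercube a \<longleftrightarrow> (\<forall>i. real (a $ i) \<le> y $ i \<and> y $ i \<le> real (a $ i) + 1)"
  by (simp add: unit_hypercube_def mem_box_cart)

lemma unit_hypercube_eq_iff: "unit_hypercube a = unit_hypercube b \<longleftrightarrow> a = b"
proof
  assume e: "unit_hypercube a = unit_hypercube b"
  have "(\<chi> i. real (c $ i)) \<in> unit_hypercube c" for c :: "nat ^ 'd" by (simp add: mem_unit_hypercube)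
  then have "(\<chi> i. real (a $ i)) \<in> unit_hypercube b" "(\<chi> i. real (b $ i)) \<in> unit_hypercube a" using e by metis+
  then have "a $ i = b $ i" for i by (auto simp: mem_unit_hypercube intro: order_antisym)
  then show "a = b" by (simp add: vec_eq_iff)
qed simp

lemma mem_cube_at:
  assumes v: "\<forall>i. i \<noteq> k \<longrightarrow> v i \<ge> 0" "v k \<ge> 1" and y: "y \<in> cube_at k v"
  shows "i \<noteq> k \<Longrightarrow> real_of_int (v i) \<le> y $ i" "i \<noteq> k \<Longrightarrow> y $ i \<le> real_of_int (v i) + 1"
    "real_of_int (v k) - 1 \<le> y $ k" "y $ k \<le> real_of_int (v k)"
proof -
  have *: "real (nat (if i = k then v i - 1 else v i)) \<le> y $ i \<and> y $ i \<le> real (nat (if i = k then v i - 1 else v i)) + 1" for i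
    using y by (simp add: cube_at_def mem_unit_hypercube)
  show "i \<noteq> k \<Longrightarrow> real_of_int (v i) \<le> y $ i" "i \<noteq> k \<Longrightarrow> y $ i \<le> real_of_int (v i) + 1" using *[of i] v(1) by auto
  show "real_of_int (v k) - 1 \<le> y $ k" "y $ k \<le> real_of_int (v k)" using *[of k] v(2) by auto
qed

text \<open>In each coordinate \<open>y - v\<close> has the sign of the coefficient of the form, so
  no term is negative and all vanish only at \<open>v\<close>. The terms add up to at most
  \<open>2 * Q\<close> for coordinate \<open>k\<close> and \<open>Q\<close> for each of the
  others.\<close>

lemma form_cube_bounds:
  fixes y :: "real ^ 'a::finite" and Q :: int
  assumes h: "h \<in> normals k Q" and Q: "Q \<ge> 1"
    and v: "\<forall>i. i \<noteq> k \<longrightarrow> v i \<ge> 0" "v k \<ge> 1" and y: "y \<in> cube_at k v"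
    and zero: "form k h (\<lambda>i. real_of_int (v i)) = 0"
  shows "0 \<le> form k h (($) y)"
    and "form k h (($) y) = 0 \<Longrightarrow> \<forall>i. y $ i = v i"
    and "form k h (($) y) \<le> (CARD('a) + 1) * Q"
proof -
  define w where "w i = (if i = k then - real_of_int (h i) else real_of_int (h i)) * (y $ i - v i)" for i
  have eq: "form k h (($) y) = (\<Sum>i\<in>UNIV. w i)"
    using zero by (simp add: form_def w_def right_diff_distrib sum_subtractf)
  note b = normalsD[OF h]
  note m = mem_cube_at[of k v y, OF v y]
  have w: "0 \<le> w i" "w i \<le> (if i = k then 2 * real_of_int Q else real_of_int Q)" "w i = 0 \<Longrightarrow> y $ i = v i" for i
  proof -
    have "0 \<le> w i \<and> w i \<le> (if i = k then 2 * real_of_int Q else real_of_int Q) \<and> (w i = 0 \<longrightarrow> y $ i = v i)"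
    proof (cases "i = k")
      case True
      have w: "w i = h k * (v k - y $ k)" using True by (simp add: w_def algebra_simps)
      have "h k * (v k - y $ k) \<le> real_of_int (2 * Q) * 1" using m b(1,2) Q by (intro mult_mono) auto
      then show ?thesis using w True m b(1) Q by auto
    next
      case False
      have w: "w i = h i * (y $ i - v i)" using False by (simp add: w_def)
      have "h i * (y $ i - v i) \<le> real_of_int Q * 1" using m(1,2)[OF False] b(3,4)[OF False] Q by (intro mult_mono) auto
      then show ?thesis using w False m(1)[OF False] b(3)[OF False] by auto
    qed
    then show "0 \<le> w i" "w i \<le> (if i = k then 2 * real_of_int Q else real_of_int Q)" "w i = 0 \<Longrightarrow> y $ i = v i" by auto
  qed
  show "0 \<le> form k h (($) y)" unfolding eq by (rule sum_nonneg) (rule w)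
  show "\<forall>i. y $ i = v i" if "form k h (($) y) = 0"
    using that w(1,3) unfolding eq by (subst (asm) sum_nonneg_eq_0_iff) auto
  have "(\<Sum>i\<in>UNIV. w i) \<le> (\<Sum>i\<in>UNIV. if i = k then 2 * real_of_int Q else real_of_int Q)"
    by (rule sum_mono) (use w(2) in auto)
  also have "\<dots> = 2 * Q + (\<Sum>i\<in>UNIV - {k}. real_of_int Q)" by (subst sum.remove[of _ k]) auto
  also have "\<dots> = (CARD('a) + 1) * real_of_int Q"
    by (simp add: card_Diff_singleton of_nat_diff Suc_leI algebra_simps)
  finally show "form k h (($) y) \<le> (CARD('a) + 1) * Q" unfolding eq by simp
qed

lemma form_affine:
  "form k h (\<lambda>i. (1 - c) * x i + c * y i) = (1 - c) * form k h x + c * form k h y"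
  unfolding form_def sum_distrib_left sum.distrib[symmetric] by (rule sum.cong) (auto simp: algebra_simps)

lemma form_unit: "form k h (\<lambda>i. if i = k then 1 else 0) = - h k"
  by (simp add: form_def if_distrib cong: if_cong)

text \<open>\<open>W\<close> is 8 times the sum of \<open>(CARD('a) + 1) * Q\<close>, the largest
  value of a form on its own cubes, and \<open>2 * Q\<close>, the most by which it can be negative
  at the start of a sight line. The 8 arises because a sight line meets cubes only after an eighth
  of its length.\<close>

locale plates =
  fixes k :: "'a::finite" and Q T W :: int
  assumes dim: "CARD('a) > 3" and Q: "Q \<ge> 1" and T: "T \<ge> 2"
    and W_def: "W = 8 * (int CARD('a) + 3) * Q"
begin

definition H :: "('a \<Rightarrow> int) set" where "H = {h \<in> normals k Q. primitive h}"

definition V :: "('a \<Rightarrow> int) set" where "V = (\<Union>h\<in>H. lift k h ` good k Q T W h)"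

lemma goodD:
  assumes "u \<in> good k Q T W h"
  shows "u k = 0" "h k dvd dot h u" "i \<noteq> k \<Longrightarrow> Q * (T - 1) < u i" "i \<noteq> k \<Longrightarrow> u i < 4 * Q * T"
    "h' \<in> H \<Longrightarrow> h' \<noteq> h \<Longrightarrow> level k h h' u \<notin> {0..W}"
  using assms by (auto simp: good_def slice_def H_def)

lemma other_coordinate: obtains i where "i \<noteq> k"
proof -
  have "UNIV \<noteq> {k}"
  proof
    assume "UNIV = {k}"
    then have "CARD('a) = card {k}" by (rule arg_cong)
    then show False using dim by simp
  qed
  then show ?thesis using that by auto
qed

text \<open>For coordinate \<open>k\<close>: \<open>dot h u\<close> is a positive multiple of
  \<open>h k\<close>, and \<open>h k > Q\<close> while the other entries of \<open>h\<close> are at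
  most \<open>Q\<close>.\<close>

lemma lift_bounds:
  assumes h: "h \<in> H" and u: "u \<in> good k Q T W h"
  shows "i \<noteq> k \<Longrightarrow> 1 \<le> lift k h u i" "i \<noteq> k \<Longrightarrow> lift k h u i < 4 * Q * T"
    "1 \<le> lift k h u k" "lift k h u k \<le> CARD('a) * (4 * Q * T)"
proof -
  have hN: "h \<in> normals k Q" using h by (simp add: H_def)
  note b = normalsD[OF hN]
  have u1: "1 \<le> u i" if "i \<noteq> k" for i
  proof -
    have "0 \<le> Q * (T - 1)" using Q T by simp
    then show ?thesis using goodD(3)[OF u that] by linarith
  qed
  show "i \<noteq> k \<Longrightarrow> 1 \<le> lift k h u i" "i \<noteq> k \<Longrightarrow> lift k h u i < 4 * Q * T"
    using u1[of i] goodD(4)[OF u, of i] by (auto simp: lift_def)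
  have nn: "0 \<le> h i * u i" for i
    using u1[of i] b(3)[of i] goodD(1)[OF u] by (cases "i = k") auto
  obtain i where i: "i \<noteq> k" by (rule other_coordinate)
  have "1 * 1 \<le> h i * u i" using u1[OF i] b(3)[OF i] by (intro mult_mono) auto
  also have "\<dots> \<le> dot h u" unfolding dot_def using nn by (intro member_le_sum) auto
  finally have d1: "1 \<le> dot h u" by simp
  then have "h k \<le> dot h u" using goodD(2)[OF u] by (intro zdvd_imp_le) auto
  then have "h k div h k \<le> dot h u div h k" using b(1) Q by (intro zdiv_mono1) auto
  then show "1 \<le> lift k h u k" using b(1) Q by (simp add: lift_def)
  have "dot h u \<le> (\<Sum>i\<in>(UNIV :: 'a set). Q * (4 * Q * T))"
    unfolding dot_def
  proof (rule sum_mono)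
    fix i
    show "h i * u i \<le> Q * (4 * Q * T)"
    proof (cases "i = k")
      case True
      then show ?thesis using goodD(1)[OF u] Q T by simp
    next
      case False
      then show ?thesis using b(3,4)[OF False] u1[OF False] goodD(4)[OF u False] Q by (intro mult_mono) auto
    qed
  qed
  also have "\<dots> = (CARD('a) * (4 * Q * T)) * Q" by simp
  finally have "dot h u \<le> (CARD('a) * (4 * Q * T)) * Q" .
  also have "\<dots> \<le> (CARD('a) * (4 * Q * T)) * h k" using b(1) Q T by (intro mult_left_mono) auto
  finally have "dot h u div h k \<le> ((CARD('a) * (4 * Q * T)) * h k) div h k" using b(1) Q by (intro zdiv_mono1) auto
  then show "lift k h u k \<le> CARD('a) * (4 * Q * T)" using b(1) Q by (simp add: lift_def)
qed

lemma V_bounds: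
  assumes "v \<in> V"
  shows "i \<noteq> k \<Longrightarrow> 1 \<le> v i" "i \<noteq> k \<Longrightarrow> v i < 4 * Q * T" "1 \<le> v k" "v k \<le> CARD('a) * (4 * Q * T)"
  using assms lift_bounds by (auto simp: V_def)

lemma inj_cube_at: "inj_on (cube_at k) V"
proof (rule inj_onI, rule ext)
  fix v v' i assume v: "v \<in> V" "v' \<in> V" "cube_at k v = cube_at k v'"
  then have "(\<chi> i. nat (if i = k then v i - 1 else v i)) $ i = (\<chi> i. nat (if i = k then v' i - 1 else v' i)) $ i"
    by (simp only: cube_at_def unit_hypercube_eq_iff)
  then show "v i = v' i" using V_bounds(1)[OF v(1), of i] V_bounds(1)[OF v(2), of i] V_bounds(3)[OF v(1)] V_bounds(3)[OF v(2)]
    by (auto split: if_splits)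
qed

text \<open>No lattice point is counted for two normals: a point on the hyperplane of
  \<open>h'\<close> has level 0 with respect to \<open>h'\<close>, which lies in the excluded range
  \<open>{0..W}\<close>.\<close>

lemma card_V: "card V = (\<Sum>h\<in>H. card (good k Q T W h))"
proof -
  have fin: "finite (good k Q T W h)" for h
    by (rule finite_subset[OF _ finite_slice[of "{Q * (T - 1)<..<4 * Q * T}" k]]) (auto simp: good_def)
  have "card V = (\<Sum>h\<in>H. card (lift k h ` good k Q T W h))"
    unfolding V_def
  proof (rule card_UN_disjoint)
    show "finite H" using finite_normals[of k Q] by (simp add: H_def)
    show "\<forall>h\<in>H. finite (lift k h ` good k Q T W h)" using fin by blast
    show "\<forall>h\<in>H. \<forall>h'\<in>H. h \<noteq> h' \<longrightarrow> lift k h ` good k Q T W h \<inter> lift k h' ` good k Q T W h' = {}"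
    proof (intro ballI impI, rule ccontr)
      fix h h' assume h: "h \<in> H" "h' \<in> H" "h \<noteq> h'"
        and "lift k h ` good k Q T W h \<inter> lift k h' ` good k Q T W h' \<noteq> {}"
      then obtain u u' where u: "u \<in> good k Q T W h" "u' \<in> good k Q T W h'" and e: "lift k h u = lift k h' u'"
        by blast
      have "real_of_int (level k h h' u) = form k h' (\<lambda>i. real_of_int (lift k h u i))"
        by (rule form_lift[symmetric]) (rule goodD(1)[OF u(1)])
      also have "\<dots> = real_of_int (level k h' h' u')"
        unfolding e by (rule form_lift) (rule goodD(1)[OF u(2)])
      also have "level k h' h' u' = 0" using goodD(2)[OF u(2)] by (rule level_self)
      finally show False using goodD(5)[OF u(1) h(2)] h(3) Q by (simp add: W_def)
    qed
  qed
  also have "\<dots> = (\<Sum>h\<in>H. card (good k Q T W h))"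
  proof (rule sum.cong[OF refl])
    fix h
    have "inj_on (lift k h) (good k Q T W h)"
      by (rule inj_onI) (meson goodD(1) lift_eqD)
    then show "card (lift k h ` good k Q T W h) = card (good k Q T W h)" by (rule card_image)
  qed
  finally show ?thesis .
qed

text \<open>Every sight line starts at the \<^term>\<open>k\<close>-th unit vector, where all the linear forms are
  negative, while each obstructing cube lies where its own form is nonnegative and small.\<close>

lemma cube_visible:
  assumes v: "v \<in> V"
  shows "visible (cube_at k ` V) (cube_at k v)"
proof -
  define x :: "real ^ 'a" where "x = (\<chi> i. if i = k then 1 else 0)"
  define p :: "real ^ 'a" where "p = (\<chi> i. real_of_int (v i))"
  have "x \<in> observer" by (simp add: observer_def mem_unit_hypercube x_def)
  moreover have "p \<in> cube_at k v"
    unfolding cube_at_def mem_unit_hypercube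
  proof
    fix i
    show "real ((\<chi> i. nat (if i = k then v i - 1 else v i)) $ i) \<le> p $ i
        \<and> p $ i \<le> real ((\<chi> i. nat (if i = k then v i - 1 else v i)) $ i) + 1"
      using V_bounds(1)[OF v, of i] V_bounds(3)[OF v] by (auto simp: p_def)
  qed
  moreover have "closed_segment x p \<inter> cube_at k v' = {}" if v': "v' \<in> V" and ne: "cube_at k v' \<noteq> cube_at k v" for v'
  proof (rule ccontr)
    assume "closed_segment x p \<inter> cube_at k v' \<noteq> {}"
    then obtain c where c: "0 \<le> c" "c \<le> 1" and y: "(1 - c) *\<^sub>R x + c *\<^sub>R p \<in> cube_at k v'"
      by (auto simp: closed_segment_def)
    define y where "y = (1 - c) *\<^sub>R x + c *\<^sub>R p"
    obtain h u where h: "h \<in> H" and u: "u \<in> good k Q T W h" and vu: "v = lift k h u"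
      using v by (auto simp: V_def)
    obtain h' u' where h': "h' \<in> H" and u': "u' \<in> good k Q T W h'" and vu': "v' = lift k h' u'"
      using v' by (auto simp: V_def)
    have hN': "h' \<in> normals k Q" using h' by (simp add: H_def)
    have zero: "form k h' (\<lambda>i. real_of_int (v' i)) = 0"
      unfolding vu' by (subst form_lift[where k = k and u = u', OF goodD(1)[OF u']]) (simp add: level_self goodD(2)[OF u'])
    have nn: "\<forall>i. i \<noteq> k \<longrightarrow> v' i \<ge> 0" using V_bounds(1)[OF v'] by force
    note fb = form_cube_bounds[OF hN' Q nn V_bounds(3)[OF v'] y[folded y_def] zero]
    have "form k h' (($) y) = form k h' (\<lambda>i. (1 - c) * (if i = k then 1 else 0) + c * real_of_int (v i))"
      by (rule arg_cong[of _ _ "form k h'"]) (auto simp: y_def x_def p_def)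
    also have "\<dots> = (1 - c) * (- h' k) + c * form k h' (\<lambda>i. real_of_int (v i))"
      by (simp only: form_affine form_unit)
    also have "form k h' (\<lambda>i. real_of_int (v i)) = level k h h' u"
      unfolding vu by (rule form_lift[where k = k and u = u, OF goodD(1)[OF u]])
    finally have fy: "form k h' (($) y) = c * level k h h' u - (1 - c) * h' k" by simp
    have hk: "h' k > 0" "h' k \<le> 2 * Q" using normalsD(1,2)[OF hN'] Q by auto
    show False
    proof (cases "level k h h' u \<le> 0")
      \<comment> \<open>The form of \<open>h'\<close> is at most 0 along the whole segment and
        nonnegative on the cube. They can meet only at \<open>c = 1\<close> and at the vertex
        \<open>v'\<close>, so that \<open>v = v'\<close>. This includes \<open>h' = h\<close>, where
        the level is 0.\<close>
      case True
      have a: "c * level k h h' u \<le> 0" using True c by (simp add: mult_nonneg_nonpos)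
      have b: "(1 - c) * h' k \<ge> 0" using c hk by simp
      have z: "form k h' (($) y) = 0" "(1 - c) * h' k = 0" using fb(1) fy a b by linarith+
      then have "c = 1" using hk by simp
      then have "y = p" by (simp add: y_def)
      then have "v i = v' i" for i using fb(2)[OF z(1)] by (simp add: p_def)
      then have "v = v'" by blast
      then show False using ne by simp
    next
      case False
      then have "h' \<noteq> h" using level_self[OF goodD(2)[OF u]] by auto
      then have "level k h h' u \<notin> {0..W}" using h' by (intro goodD(5)[OF u])
      then have lW: "level k h h' u > W" using False by simp
      \<comment> \<open>Comparing one coordinate other than \<open>k\<close>, which exceeds
        \<open>Q * (T - 1)\<close> at \<open>y\<close> and is below \<open>4 * Q * T\<close> at
        \<open>v\<close>, shows that \<open>c > 1 / 8\<close>.\<close>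
      obtain i where i: "i \<noteq> k" by (rule other_coordinate)
      have yi: "y $ i = c * v i" using i by (simp add: y_def x_def p_def)
      have "Q * (T - 1) < v' i" using goodD(3)[OF u' i] i by (simp add: vu' lift_def)
      moreover have "v' i \<le> y $ i" using mem_cube_at(1)[OF nn V_bounds(3)[OF v'] y[folded y_def] i] .
      ultimately have "real_of_int (Q * (T - 1)) < c * v i" using yi by linarith
      also have "c * v i \<le> c * real_of_int (4 * Q * T)"
        using c V_bounds(2)[OF v i] by (intro mult_left_mono) (simp_all only: of_int_le_iff less_imp_le)
      finally have "real_of_int Q * (T - 1) < real_of_int Q * (c * (4 * T))" by (simp add: mult_ac)
      then have "T - 1 < c * (4 * T)" using Q by simp
      moreover have "real_of_int T \<ge> 2" using T by simp
      ultimately have "T / 2 < c * (4 * T)" by linarith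
      then have c8: "1 / 8 < c" using T by (simp add: field_simps)
      have W0: "W > 0" using Q by (simp add: W_def)
      \<comment> \<open>Now the form of \<open>h'\<close> at \<open>y\<close> exceeds the maximum
        that \<open>form_cube_bounds\<close> allows on the cube at \<open>v'\<close>.\<close>
      have "W / 8 < c * W" using c8 W0 by simp
      also have "\<dots> \<le> c * level k h h' u" using lW c by (intro mult_left_mono) auto
      finally have "W / 8 < c * level k h h' u" .
      moreover have "(1 - c) * h' k \<le> 1 * real_of_int (2 * Q)" using c hk by (intro mult_mono) auto
      ultimately have "W / 8 - 2 * Q < form k h' (($) y)" using fy by linarith
      moreover have "W / 8 - 2 * Q = (CARD('a) + 1) * real_of_int Q" by (simp add: W_def algebra_simps)
      ultimately show False using fb(3) by simp
    qed
  qed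
  ultimately show ?thesis unfolding visible_def by blast
qed

lemma configuration:
  assumes n: "int CARD('a) * (4 * Q * T) \<le> int n"
  shows "cube_at k ` V \<in> configurations n"
  unfolding configurations_def
proof (clarify)
  fix v assume v: "v \<in> V"
  note b = V_bounds[OF v]
  have "0 \<le> 4 * Q * T" using Q T by simp
  then have "4 * Q * T \<le> int CARD('a) * (4 * Q * T)" using dim by (simp add: mult_le_cancel_right1)
  then have n': "4 * Q * T \<le> int n" using n by linarith
  have "nat (if i = k then v i - 1 else v i) < n" for i
  proof (cases "i = k")
    case True
    then show ?thesis using b(3,4) n by auto
  next
    case False
    then show ?thesis using b(1,2)[OF False] n' by auto
  qed
  then have "cube_at k v \<in> hypercubes n" unfolding hypercubes_def cube_at_def by auto
  moreover have "cube_at k v \<noteq> observer"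
  proof
    assume "cube_at k v = observer"
    then have e: "(\<chi> i. nat (if i = k then v i - 1 else v i)) = 0"
      unfolding cube_at_def observer_def unit_hypercube_eq_iff .
    obtain i where i: "i \<noteq> k" by (rule other_coordinate)
    have "nat (v i) = 0" using i arg_cong[OF e, of "\<lambda>z. z $ i"] by simp
    then show False using b(1)[OF i] by simp
  qed
  ultimately show "cube_at k v \<in> hypercubes n - {observer}" by simp
qed

text \<open>All the cubes of the configuration are visible, so the bounds for the number of
  primitive normals and for the good points of each multiply.\<close>

lemma max_visible_ge:
  assumes n: "int CARD('a) * (4 * Q * T) \<le> int n"
    and TQ: "T \<ge> scale_const TYPE('a) (8 * (int CARD('a) + 3)) * Q ^ (CARD('a) - 1)"
  shows "real (max_visible TYPE('a) n)
    \<ge> real_of_int Q ^ CARD('a) / 2 * (real_of_int Q ^ (CARD('a) - 2) * real_of_int T ^ (CARD('a) - 1) / 2)"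
proof -
  have "num_visible (cube_at k ` V) = card (cube_at k ` V)"
    unfolding num_visible_def using cube_visible by (intro arg_cong[of _ _ card]) auto
  also have "\<dots> = card V" by (rule card_image[OF inj_cube_at])
  finally have nv: "num_visible (cube_at k ` V) = card V" .
  have "num_visible (cube_at k ` V) \<le> max_visible TYPE('a) n"
    unfolding max_visible_def using configuration[OF n] finite_configurations by (intro Max_ge) auto
  then have "real (max_visible TYPE('a) n) \<ge> (\<Sum>h\<in>H. real (card (good k Q T W h)))"
    unfolding nv card_V by (simp add: of_nat_sum[symmetric] del: of_nat_sum)
  moreover have "(\<Sum>h\<in>H. real (card (good k Q T W h)))
      \<ge> (\<Sum>h\<in>H. real_of_int Q ^ (CARD('a) - 2) * real_of_int T ^ (CARD('a) - 1) / 2)"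
    unfolding W_def using T TQ dim Q by (intro sum_mono card_good_ge) (auto simp: H_def)
  moreover have "(\<Sum>h\<in>H. real_of_int Q ^ (CARD('a) - 2) * real_of_int T ^ (CARD('a) - 1) / 2)
      \<ge> real_of_int Q ^ CARD('a) / 2 * (real_of_int Q ^ (CARD('a) - 2) * real_of_int T ^ (CARD('a) - 1) / 2)"
    unfolding sum_constant H_def using card_primitive_normals[OF dim Q, of k] Q T
    by (intro mult_right_mono) auto
  ultimately show ?thesis by linarith
qed

end

section \<open>Choice of the parameters and the final bound\<close>

lemma max_visible_pos:
  assumes "n > 1"
  shows "max_visible TYPE('d::finite) n \<ge> 1"
proof -
  define c :: "(real ^ 'd) set" where "c = unit_hypercube (\<chi> i. 1)"
  have "c \<noteq> observer" unfolding c_def observer_def unit_hypercube_eq_iff by (simp add: vec_eq_iff)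
  moreover have "c \<in> hypercubes n" using assms by (auto simp: hypercubes_def c_def)
  ultimately have conf: "{c} \<in> configurations n" by (simp add: configurations_def)
  have "(0 :: real ^ 'd) \<in> observer" "(\<chi> i. 1) \<in> c"
    by (simp_all add: observer_def c_def mem_unit_hypercube)
  then have "visible {c} c" unfolding visible_def by blast
  then have "num_visible {c} = card {c}" unfolding num_visible_def by (intro arg_cong[of _ _ card]) auto
  moreover have "num_visible {c} \<le> max_visible TYPE('d) n"
    unfolding max_visible_def using conf finite_configurations by (intro Max_ge) auto
  ultimately show ?thesis by simp
qed

theorem theorem4p2:
  assumes "CARD('d::finite) > 3"
  shows "\<exists>c::real. c > 0 \<and> (\<forall>n::nat. n > 3 \<longrightarrow>
    real (max_visible TYPE('d) n) \<ge> c * real n powr (real CARD('d) - 1 / real CARD('d)))"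
proof -
  define d where "d = CARD('d)"
  define e where "e = real d - 1 / real d"
  define A where "A = scale_const TYPE('d) (8 * (int CARD('d) + 3))"
  \<comment> \<open>With \<open>T = A * Q ^ (d - 1)\<close> the side length needed by the
    configuration, \<open>d * (4 * Q * T)\<close>, is exactly \<open>B * Q ^ d\<close>.\<close>
  define B where "B = 4 * real d * A"
  \<comment> \<open>The total power of \<open>Q\<close> in the bound of
    \<open>max_visible_ge\<close>. As \<open>Q ^ d\<close> is of order \<open>n\<close>, it becomes
    the exponent \<open>N / d = d - 1 / d\<close> of \<open>n\<close>.\<close>
  define N where "N = d * d - 1"
  have d: "d > 3" using assms by (simp add: d_def)
  have A: "A \<ge> 2"
  proof -
    have "(1::int) * 2 \<le> 2 ^ (CARD('d) - 1) * 2" by (intro mult_right_mono) auto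
    also have "\<dots> \<le> A" unfolding A_def scale_const_def
    proof (rule mult_left_mono)
      have "1 * 1 \<le> 4 * int CARD('d) * 3 ^ CARD('d)"
        using assms by (intro mult_mono) auto
      moreover have "0 \<le> 8 * (int CARD('d) + 3) * (3 ^ CARD('d) + 8 * int CARD('d) * 6 ^ CARD('d))" by simp
      ultimately show "2 \<le> 8 * (int CARD('d) + 3) * (3 ^ CARD('d) + 8 * int CARD('d) * 6 ^ CARD('d))
          + (1 + 4 * int CARD('d) * 3 ^ CARD('d))" by linarith
    qed simp
    finally show ?thesis by simp
  qed
  have B: "B \<ge> 1"
  proof -
    have "1 * 1 \<le> (4 * real d) * A" using d A by (intro mult_mono) auto
    then show ?thesis by (simp add: B_def)
  qed
  have N: "e * d = N" "d + (d - 2) + (d - 1) * (d - 1) = N"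
  proof -
    obtain m where "d = m + 4" using d that[of "d - 4"] by simp
    then show "e * d = N" "d + (d - 2) + (d - 1) * (d - 1) = N" by (auto simp: e_def N_def field_simps)
  qed
  have e0: "e \<ge> 0"
  proof -
    have "1 / real d \<le> 1" "1 \<le> real d" using d by simp_all
    then show ?thesis unfolding e_def by linarith
  qed
  \<comment> \<open>The first entry serves for \<open>n < B\<close>, where one visible cube
    suffices, and the second for \<open>n \<ge> B\<close>. Its factor \<open>2 ^ N\<close> pays for
    rounding \<open>x\<close> down to \<open>Q\<close>.\<close>
  define c where "c = min (B powr (- e)) (A ^ (d - 1) / (4 * 2 ^ N) * B powr (- e))"
  have "c > 0" using A B by (simp add: c_def)
  moreover have "c * real n powr e \<le> real (max_visible TYPE('d) n)" if n: "n > 3" for n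
  proof (cases "real n < B")
    case True
    have "c * real n powr e \<le> B powr (- e) * B powr e"
      using True B e0 by (intro mult_mono powr_mono2) (auto simp: c_def)
    also have "\<dots> = 1" using B by (simp add: powr_minus)
    also have "\<dots> \<le> real (max_visible TYPE('d) n)" using max_visible_pos[of n, where 'd = 'd] n by simp
    finally show ?thesis .
  next
    case False
    \<comment> \<open>The real solution of \<open>B * x ^ d = n\<close>; its integer part
      \<open>Q\<close> is at least \<open>x / 2\<close>, because \<open>x \<ge> 1\<close>.\<close>
    define x where "x = (n / B) powr (1 / d)"
    have nB: "n / B \<ge> 1" using False B by simp
    have x1: "x \<ge> 1" unfolding x_def using nB by (intro ge_one_powr_ge_zero) auto
    have xpow: "x ^ j = (n / B) powr (j / d)" for j
    proof -
      have "x ^ j = x powr j" using x1 by (simp add: powr_realpow)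
      then show ?thesis by (simp add: x_def powr_powr)
    qed
    define Q where "Q = \<lfloor>x\<rfloor>"
    have Q: "Q \<ge> 1" "real_of_int Q \<le> x" using x1 unfolding Q_def by simp_all
    have "x < real_of_int Q + 1" unfolding Q_def by linarith
    then have Q2: "x \<le> 2 * Q" using Q(1) by simp
    define T where "T = A * Q ^ (d - 1)"
    obtain k :: 'd where True by simp
    have T: "T \<ge> 2"
    proof -
      have "2 * 1 \<le> A * Q ^ (d - 1)" using A Q by (intro mult_mono) auto
      then show ?thesis by (simp add: T_def)
    qed
    interpret P: plates k Q T "8 * (int CARD('d) + 3) * Q" by unfold_locales (use assms Q T in auto)
    have "real_of_int Q ^ d \<le> x ^ d" using Q by (intro power_mono) auto
    also have "\<dots> = n / B" using xpow[of d] nB B d by simp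
    finally have "B * real_of_int Q ^ d \<le> n" using B by (simp add: field_simps)
    moreover have "real_of_int (int CARD('d) * (4 * Q * T)) = B * real_of_int Q ^ d"
      using d by (cases d) (simp_all add: B_def T_def d_def[symmetric])
    ultimately have "real_of_int (int CARD('d) * (4 * Q * T)) \<le> real_of_int (int n)" by simp
    then have nQ: "int CARD('d) * (4 * Q * T) \<le> int n" by (simp only: of_int_le_iff)
    have "c * real n powr e \<le> (A ^ (d - 1) / (4 * 2 ^ N) * B powr (- e)) * real n powr e"
      by (intro mult_right_mono) (auto simp: c_def)
    also have "\<dots> = A ^ (d - 1) / (4 * 2 ^ N) * (n / B) powr e"
      using B by (simp add: powr_divide powr_minus field_simps)
    also have "(n / B) powr e = x ^ N"
      using xpow[of N] d by (simp add: N(1)[symmetric])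
    also have "A ^ (d - 1) / (4 * 2 ^ N) * x ^ N \<le> A ^ (d - 1) / (4 * 2 ^ N) * (2 * real_of_int Q) ^ N"
      using A x1 Q2 by (intro mult_left_mono power_mono) auto
    also have "\<dots> = A ^ (d - 1) / 4 * real_of_int Q ^ N" by (simp add: power_mult_distrib)
    also have "\<dots> = real_of_int Q ^ d / 2 * (real_of_int Q ^ (d - 2) * real_of_int T ^ (d - 1) / 2)"
      by (simp add: N(2)[symmetric] T_def power_add power_mult power_mult_distrib)
    also have "\<dots> \<le> real (max_visible TYPE('d) n)"
      unfolding d_def using nQ by (rule P.max_visible_ge) (simp add: T_def A_def d_def)
    finally show ?thesis .
  qed
  ultimately show ?thesis unfolding e_def d_def by blast
qed

end
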